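(* Let $L$ be a finite simplicial complex on vertex set $\mathsf V$, let $\Bbbk$ be a field, and let $i,d\ge 1$ be integers. Then the resonance varieties of the toric complex $T_L$ over $\Bbbk$ are given by $$\mathcal R^i_d(T_L,\Bbbk)=\bigcup_{\substack{\mathsf W\subset\mathsf V\\ \beta_i(\Bbbk\langle L\rangle,\mathsf W)\ge d}}\Bbbk^{\mathsf W}.$$
   Context: Simplices are identified with their vertex sets; every $v\in\mathsf V$ is a vertex of $L$. Give $S^1$ the CW-structure with one $0$-cell $*$ and one $1$-cell. The toric complex is the subcomplex $T_L=\bigcup_{\sigma\in L}\{x: x_v=*\text{ for }v\notin\sigma\}$ of $(S^1)^{\mathsf V}$. Let $V$ be the $\Bbbk$-vector space with basis $\mathsf V$, and $V^*$ its dual with dual basis $\{v^*\}_{v\in\mathsf V}$. The exterior Stanley–Reisner ring is $\Bbbk\langle L\rangle=\bigwedge V^*/J_L$, where $J_L$ is the ideal generated by all monomials $v_{i_1}^*\cdots v_{i_k}^*$ with $\{v_{i_1},\dots,v_{i_k}\}\notin L$. One has $H^*(T_L,\Bbbk)=\Bbbk\langle L\rangle$. For a connected, locally finite graded $\Bbbk$-algebra $A$ with $z^2=0$ for all $z\in A^1$, and $z\in A^1$, let $(A,z)$ be the cochain complex $A^0\xrightarrow{z}A^1\xrightarrow{z}A^2\to\cdots$ given by right multiplication by $z$, and put $\beta_i(A,z)=\dim_\Bbbk H^i(A,z)$. The resonance varieties are $\mathcal R^i_d(A)=\{z\in A^1\mid\beta_i(A,z)\ge d\}$, and $\mathcal R^i_d(T_L,\Bbbk)=\mathcal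 R^i_d(H^*(T_L,\Bbbk))\subseteq \Bbbk\langle L\rangle^1=V^*=\Bbbk^{\mathsf V}$. For $\mathsf W\subset\mathsf V$ (possibly empty or all of $\mathsf V$), $z_{\mathsf W}=\sum_{v\in\mathsf W}v^*$ (so $z_\emptyset=0$), $\beta_i(\Bbbk\langle L\rangle,\mathsf W):=\beta_i(\Bbbk\langle L\rangle,z_{\mathsf W})$, and $\Bbbk^{\mathsf W}\subseteq\Bbbk^{\mathsf V}$ is the coordinate subspace spanned by $\{v^*\}_{v\in\mathsf W}$. *)

theory Defs
  imports "HOL-Homology.Homology" "HOL-Algebra.QuotRing" "Jordan_Normal_Form.VS_Connect"
begin

text \<open>The ground field is a type of class \<open>field\<close>; as the scalar ring of a module it appears as
  \<open>class_ring\<close>, whose carrier is the whole type.\<close>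


section \<open>Graded algebras, quotients, resonance varieties\<close>

record ('k, 'a) graded_algebra = "('k, 'a) module" +
  grade :: "nat \<Rightarrow> 'a set"

text \<open>Scalars act on cosets by \<open>c \<cdot> (N + x) = N + c \<cdot> x\<close>. Adding \<open>N\<close> to the pointwise multiple
  of a coset is needed only for \<open>c = 0\<close>.\<close>

definition quot_space :: "('k, 'a, 'm) module_scheme \<Rightarrow> 'a set \<Rightarrow> ('k, 'a set) module" where
  "quot_space M N =
     ring.extend (M Quot N)
       (module.fields (\<lambda>c X. N <+>\<^bsub>M\<^esub> ((\<lambda>x. c \<odot>\<^bsub>M\<^esub> x) ` X)))"

definition quot_algebra :: "('k, 'a, 'm) graded_algebra_scheme \<Rightarrow> 'a set \<Rightarrow> ('k, 'a set) graded_algebra" where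
  "quot_algebra A I =
     module.extend (quot_space A I)
       (graded_algebra.fields (\<lambda>n. (\<lambda>a. I +>\<^bsub>A\<^esub> a) ` grade A n))"

definition graded_algebra_iso ::
    "('k::field, 'a, 'm) graded_algebra_scheme \<Rightarrow> ('k, 'b, 'n) graded_algebra_scheme \<Rightarrow> ('a \<Rightarrow> 'b) set" where
  "graded_algebra_iso A B =
     {\<phi>. \<phi> \<in> ring_iso A B \<and> \<phi> \<in> module_hom class_ring A B \<and> (\<forall>n. \<phi> ` grade A n = grade B n)}"

text \<open>The complex \<open>(A, z)\<close>: \<open>A\<^sup>0 \<longrightarrow> A\<^sup>1 \<longrightarrow> A\<^sup>2 \<longrightarrow> \<dots>\<close> with all maps right multiplication by \<open>z\<close>.\<close>

definition mult_cocycles :: "('k, 'a, 'm) graded_algebra_scheme \<Rightarrow> 'a \<Rightarrow> nat \<Rightarrow> 'a set" where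
  "mult_cocycles A z i = {a \<in> grade A i. a \<otimes>\<^bsub>A\<^esub> z = \<zero>\<^bsub>A\<^esub>}"

definition mult_coboundaries :: "('k, 'a, 'm) graded_algebra_scheme \<Rightarrow> 'a \<Rightarrow> nat \<Rightarrow> 'a set" where
  "mult_coboundaries A z i =
     (if i = 0 then {\<zero>\<^bsub>A\<^esub>} else (\<lambda>a. a \<otimes>\<^bsub>A\<^esub> z) ` grade A (i - 1))"

definition mult_cohomology :: "('k, 'a, 'm) graded_algebra_scheme \<Rightarrow> 'a \<Rightarrow> nat \<Rightarrow> ('k, 'a set) module" where
  "mult_cohomology A z i =
     quot_space (A\<lparr>carrier := mult_cocycles A z i\<rparr>) (mult_coboundaries A z i)"

text \<open>\<open>vectorspace.dim\<close> is meaningful for finite-dimensional spaces, which is the case here as long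
  as \<open>A\<close> is locally finite.\<close>

definition betti :: "('k::field, 'a, 'm) graded_algebra_scheme \<Rightarrow> 'a \<Rightarrow> nat \<Rightarrow> nat" where
  "betti A z i = vectorspace.dim class_ring (mult_cohomology A z i)"

definition resonance :: "('k::field, 'a, 'm) graded_algebra_scheme \<Rightarrow> nat \<Rightarrow> nat \<Rightarrow> 'a set" where
  "resonance A i d = {z \<in> grade A 1. betti A z i \<ge> d}"


section \<open>The exterior Stanley--Reisner ring\<close>

text \<open>Simplices are their vertex sets; the empty simplex is always present.\<close>

definition simplicial_complex_on :: "'v set \<Rightarrow> 'v set set \<Rightarrow> bool" where
  "simplicial_complex_on V L \<longleftrightarrow>
     finite V \<and> L \<subseteq> Pow V \<and> {} \<in> L \<and> (\<forall>v\<in>V. {v} \<in> L) \<and>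
     (\<forall>\<sigma>\<in>L. \<forall>\<tau>. \<tau> \<subseteq> \<sigma> \<longrightarrow> \<tau> \<in> L)"

text \<open>The tensor algebra of \<open>V\<^sup>*\<close> in coordinates: its basis consists of the words over \<open>V\<close>, the word
  \<open>[v\<^sub>1, \<dots>, v\<^sub>k]\<close> standing for \<open>v\<^sub>1\<^sup>* \<otimes> \<dots> \<otimes> v\<^sub>k\<^sup>*\<close>, and an element is the finitely supported function of
  its coefficients. Its degree-one part is \<open>V\<^sup>*\<close> itself.\<close>

definition tensor_algebra :: "'v set \<Rightarrow> ('k::field, 'v list \<Rightarrow> 'k) graded_algebra" where
  "tensor_algebra V =
     (let T = {f. finite {w. f w \<noteq> 0} \<and> {w. f w \<noteq> 0} \<subseteq> lists V} in
      \<lparr>carrier = T,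
       mult = (\<lambda>f g w. \<Sum>j\<le>length w. f (take j w) * g (drop j w)),
       one = (\<lambda>w. if w = [] then 1 else 0),
       zero = (\<lambda>w. 0),
       add = (\<lambda>f g w. f w + g w),
       smult = (\<lambda>c f w. c * f w),
       grade = (\<lambda>n. {f \<in> T. \<forall>w. f w \<noteq> 0 \<longrightarrow> length w = n})\<rparr>)"

definition exterior_ideal :: "'v set \<Rightarrow> ('v list \<Rightarrow> 'k::field) set" where
  "exterior_ideal V =
     Idl\<^bsub>tensor_algebra V\<^esub> {x \<otimes>\<^bsub>tensor_algebra V\<^esub> x | x. x \<in> grade (tensor_algebra V) 1}"

definition exterior_algebra :: "'v set \<Rightarrow> ('k::field, ('v list \<Rightarrow> 'k) set) graded_algebra" where
  "exterior_algebra V = quot_algebra (tensor_algebra V) (exterior_ideal V)"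

definition exterior_monomial :: "'v set \<Rightarrow> 'v list \<Rightarrow> ('v list \<Rightarrow> 'k::field) set" where
  "exterior_monomial V w = exterior_ideal V +>\<^bsub>tensor_algebra V\<^esub> (\<lambda>u. if u = w then 1 else 0)"

definition SR_ideal :: "'v set \<Rightarrow> 'v set set \<Rightarrow> ('v list \<Rightarrow> 'k::field) set set" where
  "SR_ideal V L =
     Idl\<^bsub>exterior_algebra V\<^esub> {exterior_monomial V w | w. w \<in> lists V \<and> set w \<notin> L}"

definition SR_algebra ::
    "'v set \<Rightarrow> 'v set set \<Rightarrow> ('k::field, ('v list \<Rightarrow> 'k) set set) graded_algebra" where
  "SR_algebra V L = quot_algebra (exterior_algebra V) (SR_ideal V L)"

definition SR_gen :: "'v set \<Rightarrow> 'v set set \<Rightarrow> 'v \<Rightarrow> ('v list \<Rightarrow> 'k::field) set set" where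
  "SR_gen V L v = SR_ideal V L +>\<^bsub>exterior_algebra V\<^esub> exterior_monomial V [v]"

text \<open>\<open>z\<^sub>W\<close>, the sum of the \<open>v\<^sup>*\<close> with \<open>v \<in> W\<close>\<close>

definition SR_sum :: "'v set \<Rightarrow> 'v set set \<Rightarrow> 'v set \<Rightarrow> ('v list \<Rightarrow> 'k::field) set set" where
  "SR_sum V L W = finsum (SR_algebra V L) (SR_gen V L) W"

definition coord_subspace :: "'v set \<Rightarrow> 'v set set \<Rightarrow> 'v set \<Rightarrow> ('v list \<Rightarrow> 'k::field) set set set" where
  "coord_subspace V L W =
     LinearCombinations.module.span class_ring (SR_algebra V L) (SR_gen V L ` W)"


section \<open>The toric complex and singular cohomology\<close>

text \<open>The circle is the unit circle in the complex plane with base point \<open>1\<close>.\<close>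

definition toric_complex :: "'v set \<Rightarrow> 'v set set \<Rightarrow> ('v \<Rightarrow> complex) topology" where
  "toric_complex V L =
     subtopology (product_topology (\<lambda>v. top_of_set (sphere 0 1)) V)
       (\<Union>\<sigma>\<in>L. {x. \<forall>v\<in>V - \<sigma>. x v = 1})"

definition front_face :: "nat \<Rightarrow> ((nat \<Rightarrow> real) \<Rightarrow> 'a) \<Rightarrow> (nat \<Rightarrow> real) \<Rightarrow> 'a" where
  "front_face p f = restrict f (standard_simplex p)"

text \<open>The face of an \<open>n\<close>-simplex on its vertices \<open>p, \<dots>, n\<close>\<close>

definition back_face :: "nat \<Rightarrow> nat \<Rightarrow> ((nat \<Rightarrow> real) \<Rightarrow> 'a) \<Rightarrow> (nat \<Rightarrow> real) \<Rightarrow> 'a" where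
  "back_face n p f =
     restrict (\<lambda>x. f (\<lambda>i. if i < p then 0 else x (i - p))) (standard_simplex (n - p))"

text \<open>An element of the direct sum of all \<open>C\<^sup>n(X; k)\<close> is a function \<open>c\<close> whose component \<open>c n\<close>
  assigns a scalar to every singular \<open>n\<close>-simplex; \<open>c n\<close> is zero on everything that is not a singular
  \<open>n\<close>-simplex, and almost all components vanish. The multiplication is the cup product
  \<open>(a \<smile> b)(f) = a(f|[0..p]) \<cdot> b(f|[p..n])\<close>, summed over \<open>p\<close>.\<close>

definition singular_cochains ::
    "'a topology \<Rightarrow> ('k::field, nat \<Rightarrow> ((nat \<Rightarrow> real) \<Rightarrow> 'a) \<Rightarrow> 'k) graded_algebra" where
  "singular_cochains X =
     (let C = {c. (\<forall>n f. \<not> singular_simplex n X f \<longrightarrow> c n f = 0) \<and> finite {n. \<exists>f. c n f \<noteq> 0}} in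
      \<lparr>carrier = C,
       mult = (\<lambda>a b n f. if singular_simplex n X f
                 then \<Sum>p\<le>n. a p (front_face p f) * b (n - p) (back_face n p f) else 0),
       one = (\<lambda>n f. if n = 0 \<and> singular_simplex n X f then 1 else 0),
       zero = (\<lambda>n f. 0),
       add = (\<lambda>a b n f. a n f + b n f),
       smult = (\<lambda>r a n f. r * a n f),
       grade = (\<lambda>m. {c \<in> C. \<forall>n f. c n f \<noteq> 0 \<longrightarrow> n = m})\<rparr>)"

definition coboundary ::
    "'a topology \<Rightarrow> (nat \<Rightarrow> ((nat \<Rightarrow> real) \<Rightarrow> 'a) \<Rightarrow> 'k::field) \<Rightarrow> nat \<Rightarrow> ((nat \<Rightarrow> real) \<Rightarrow> 'a) \<Rightarrow> 'k" where
  "coboundary X c n f =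
     (if 0 < n \<and> singular_simplex n X f
      then \<Sum>j\<le>n. (-1) ^ j * c (n - 1) (singular_face n j f) else 0)"

definition singular_cocycles :: "'a topology \<Rightarrow> (nat \<Rightarrow> ((nat \<Rightarrow> real) \<Rightarrow> 'a) \<Rightarrow> 'k::field) set" where
  "singular_cocycles X =
     {c \<in> carrier (singular_cochains X). coboundary X c = \<zero>\<^bsub>singular_cochains X\<^esub>}"

definition cohomology_algebra ::
    "'a topology \<Rightarrow> ('k::field, (nat \<Rightarrow> ((nat \<Rightarrow> real) \<Rightarrow> 'a) \<Rightarrow> 'k) set) graded_algebra" where
  "cohomology_algebra X =
     quot_algebra
       ((singular_cochains X)
          \<lparr>carrier := singular_cocycles X,
           grade := \<lambda>n. singular_cocycles X \<inter> grade (singular_cochains X) n\<rparr>)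
       (coboundary X ` carrier (singular_cochains X))"

end

theory Submission
  imports Defs "Jordan_Normal_Form.DL_Rank"
begin

text \<open>
  The Betti number \<open>\<beta>\<^sub>i(k\<langle>L\<rangle>, z)\<close> of a linear form \<open>z\<close> can only grow when the support of \<open>z\<close>
  shrinks (\<open>betti_support_antimono\<close>). In particular it depends on the support alone, so a form \<open>z\<close>
  with support \<open>W\<close> is resonant exactly when \<open>z\<^sub>W\<close> is, and then \<open>z\<close> lies in \<open>k\<^sup>W\<close>; and if \<open>z\<^sub>W\<close> is
  resonant, so is every form in \<open>k\<^sup>W\<close>, because its support is contained in \<open>W\<close>. This is the
  asserted union.

  The monotonicity rests on two facts. First, by rank-nullity \<open>\<beta>\<^sub>i(z)\<close> is, up to a constant
  independent of \<open>z\<close>, the sum of the dimensions of the annihilators of \<open>z\<close> in degrees \<open>i\<close> and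
  \<open>i - 1\<close> (\<open>betti_add_fdim\<close>). Second, an annihilator can only grow when the support shrinks to a
  subset \<open>W\<close> (\<open>fdim_annihilator_le\<close>): if \<open>a z = 0\<close>, then the component of \<open>a\<close> of lowest degree
  in the vertices outside \<open>W\<close> is annihilated by the part of \<open>z\<close> inside \<open>W\<close>, and passing to lowest
  components preserves dimensions (\<open>fdim_filtration_le\<close>); the torus \<open>(k\<^sup>*)\<^sup>V\<close>, acting by
  automorphisms, then moves this part to any other form with support \<open>W\<close>. Both steps use that the
  ideal defining \<open>k\<langle>L\<rangle>\<close> is multigraded (\<open>SR_kernel_reweight\<close>).

  All computations take place in the tensor algebra, whose elements are functions on words, modulo
  the kernel \<open>J\<close> of its projection to \<open>k\<langle>L\<rangle>\<close>. Composing the projection with an isomorphism from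
  \<open>k\<langle>L\<rangle>\<close> to the cohomology algebra yields a presentation of the latter with the same kernel, so
  the two algebras have the same Betti numbers and their resonance varieties correspond.
\<close>

section \<open>Spaces of functions and their linear images\<close>

text \<open>The fields \<open>mult\<close> and \<open>one\<close> come from the ring record that module records extend; their
  values are arbitrary.\<close>

definition fun_space :: "('x \<Rightarrow> 'k::field) set \<Rightarrow> ('k, 'x \<Rightarrow> 'k) module" where
  "fun_space S =
     \<lparr>carrier = S, mult = (\<lambda>f g. f), one = (\<lambda>_. 0), zero = (\<lambda>_. 0),
      add = (\<lambda>f g x. f x + g x), smult = (\<lambda>c f x. c * f x)\<rparr>"

lemma fun_space_simps [simp]:
  "carrier (fun_space S) = S" "zero (fun_space S) = (\<lambda>_. 0)"
  "f \<oplus>\<^bsub>fun_space S\<^esub> g = (\<lambda>x. f x + g x)" "c \<odot>\<^bsub>fun_space S\<^esub> f = (\<lambda>x. c * f x)"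
  "(fun_space S)\<lparr>carrier := S'\<rparr> = fun_space S'"
  by (simp_all add: fun_space_def)

definition lin_closed :: "('x \<Rightarrow> 'k::field) set \<Rightarrow> bool" where
  "lin_closed S \<longleftrightarrow> (\<lambda>_. 0) \<in> S \<and> (\<forall>f\<in>S. \<forall>g\<in>S. (\<lambda>x. f x + g x) \<in> S) \<and>
     (\<forall>c. \<forall>f\<in>S. (\<lambda>x. c * f x) \<in> S)"

lemma lin_closedD:
  assumes "lin_closed S"
  shows "(\<lambda>_. 0) \<in> S"
    and "f \<in> S \<Longrightarrow> g \<in> S \<Longrightarrow> (\<lambda>x. f x + g x) \<in> S"
    and "f \<in> S \<Longrightarrow> (\<lambda>x. c * f x) \<in> S"
    and "f \<in> S \<Longrightarrow> g \<in> S \<Longrightarrow> (\<lambda>x. f x - g x) \<in> S"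
proof -
  show 1: "(\<lambda>_. 0) \<in> S"
    and 2: "\<And>f g. f \<in> S \<Longrightarrow> g \<in> S \<Longrightarrow> (\<lambda>x. f x + g x) \<in> S"
    and 3: "\<And>c f. f \<in> S \<Longrightarrow> (\<lambda>x. c * f x) \<in> S"
    using assms by (auto simp: lin_closed_def)
  show "(\<lambda>x. f x - g x) \<in> S" if "f \<in> S" "g \<in> S"
    using 2[OF that(1) 3[OF that(2), of "-1"]] by simp
qed

text \<open>\<open>linear_onto S M \<Phi>\<close> presents \<open>M\<close> as a linear image of the function space \<open>S\<close>, from which
  \<open>M\<close> inherits the vector space axioms. Iterated coset constructions stay tractable in this form,
  because each of them is presented by functions on words. The zero has to be mentioned because
  \<open>\<Phi> 0\<close> is neutral in \<open>M\<close>, but need not be the designated \<open>\<zero>\<close> of the record.\<close>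

definition linear_onto ::
    "('x \<Rightarrow> 'k::field) set \<Rightarrow> ('k, 'a, 'm) module_scheme \<Rightarrow> (('x \<Rightarrow> 'k) \<Rightarrow> 'a) \<Rightarrow> bool" where
  "linear_onto S M \<Phi> \<longleftrightarrow>
     lin_closed S \<and> \<Phi> ` S = carrier M \<and> \<Phi> (\<lambda>_. 0) = \<zero>\<^bsub>M\<^esub> \<and>
     (\<forall>f\<in>S. \<forall>g\<in>S. \<Phi> (\<lambda>x. f x + g x) = \<Phi> f \<oplus>\<^bsub>M\<^esub> \<Phi> g) \<and>
     (\<forall>c. \<forall>f\<in>S. \<Phi> (\<lambda>x. c * f x) = c \<odot>\<^bsub>M\<^esub> \<Phi> f)"

lemma linear_ontoD:
  assumes "linear_onto S M \<Phi>"
  shows "lin_closed S" "\<Phi> ` S = carrier M" "\<Phi> (\<lambda>_. 0) = \<zero>\<^bsub>M\<^esub>"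
    and "f \<in> S \<Longrightarrow> g \<in> S \<Longrightarrow> \<Phi> (\<lambda>x. f x + g x) = \<Phi> f \<oplus>\<^bsub>M\<^esub> \<Phi> g"
    and "f \<in> S \<Longrightarrow> \<Phi> (\<lambda>x. c * f x) = c \<odot>\<^bsub>M\<^esub> \<Phi> f"
    and "f \<in> S \<Longrightarrow> \<Phi> f \<in> carrier M"
  using assms by (auto simp: linear_onto_def)

lemma linear_onto_module:
  fixes M :: "('k::field, 'a, 'm) module_scheme"
  assumes "linear_onto S M \<Phi>"
  shows "module class_ring M"
proof -
  note D = linear_ontoD[OF assms] and C = lin_closedD[OF linear_ontoD(1)[OF assms]]
  have ex: "\<exists>f\<in>S. x = \<Phi> f" if "x \<in> carrier M" for x
    using that D(2) by blast
  show ?thesis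
  proof (rule module_criteria; (intro ballI allI impI; (elim conjE)?)?)
    show "cring (class_ring :: 'k ring)" by (rule class_cring.is_cring)
    show "\<zero>\<^bsub>M\<^esub> \<in> carrier M" using D(6)[OF C(1)] D(3) by simp
  next
    fix v w assume "v \<in> carrier M" "w \<in> carrier M"
    then obtain f g where fg: "f \<in> S" "g \<in> S" "v = \<Phi> f" "w = \<Phi> g" using ex by metis
    show "v \<oplus>\<^bsub>M\<^esub> w \<in> carrier M" using D(4)[OF fg(1,2)] D(6)[OF C(2)[OF fg(1,2)]] fg by simp
    show "v \<oplus>\<^bsub>M\<^esub> w = w \<oplus>\<^bsub>M\<^esub> v"
      using D(4)[OF fg(1,2)] D(4)[OF fg(2,1)] fg by (simp add: add.commute)
  next
    fix v assume "v \<in> carrier M"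
    then obtain f where f: "f \<in> S" "v = \<Phi> f" using ex by metis
    have m: "(\<lambda>x. -1 * f x) \<in> S" using C(3)[OF f(1)] .
    have "v \<oplus>\<^bsub>M\<^esub> \<Phi> (\<lambda>x. -1 * f x) = \<zero>\<^bsub>M\<^esub>"
      using D(4)[OF f(1) m] D(3) f(2) by simp
    then show "\<exists>neg_v\<in>carrier M. v \<oplus>\<^bsub>M\<^esub> neg_v = \<zero>\<^bsub>M\<^esub>" using D(6)[OF m] by blast
    show "v \<oplus>\<^bsub>M\<^esub> \<zero>\<^bsub>M\<^esub> = v" using D(4)[OF f(1) C(1), symmetric] D(3) f(2) by simp
    show "\<one>\<^bsub>class_ring\<^esub> \<odot>\<^bsub>M\<^esub> v = v" using D(5)[OF f(1), of 1, symmetric] f(2) by simp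
  next
    fix c :: 'k and v assume "v \<in> carrier M"
    then obtain f where f: "f \<in> S" "v = \<Phi> f" using ex by metis
    show "c \<odot>\<^bsub>M\<^esub> v \<in> carrier M" using D(5)[OF f(1), of c] D(6)[OF C(3)[OF f(1), of c]] f(2) by simp
  next
    fix v w x assume "v \<in> carrier M" "w \<in> carrier M" "x \<in> carrier M"
    then obtain f g h where *: "f \<in> S" "g \<in> S" "h \<in> S" "v = \<Phi> f" "w = \<Phi> g" "x = \<Phi> h"
      using ex by metis
    show "v \<oplus>\<^bsub>M\<^esub> w \<oplus>\<^bsub>M\<^esub> x = v \<oplus>\<^bsub>M\<^esub> (w \<oplus>\<^bsub>M\<^esub> x)"
      using D(4)[OF C(2)[OF *(1,2)] *(3)] D(4)[OF *(1) C(2)[OF *(2,3)]]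
        D(4)[OF *(1,2)] D(4)[OF *(2,3)] * by (simp add: add.assoc)
  next
    fix a b :: 'k and v assume "v \<in> carrier M"
    then obtain f where f: "f \<in> S" "v = \<Phi> f" using ex by metis
    show "(a \<otimes>\<^bsub>class_ring\<^esub> b) \<odot>\<^bsub>M\<^esub> v = a \<odot>\<^bsub>M\<^esub> (b \<odot>\<^bsub>M\<^esub> v)"
      using D(5)[OF f(1), of "a * b"] D(5)[OF f(1), of b] D(5)[OF C(3)[OF f(1)], of a b] f(2)
      by (simp add: mult.assoc)
    show "(a \<oplus>\<^bsub>class_ring\<^esub> b) \<odot>\<^bsub>M\<^esub> v = a \<odot>\<^bsub>M\<^esub> v \<oplus>\<^bsub>M\<^esub> b \<odot>\<^bsub>M\<^esub> v"
      using D(5)[OF f(1), of "a + b"] D(5)[OF f(1), of b] D(5)[OF f(1), of a] f(2)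
        D(4)[OF C(3)[OF f(1), of a] C(3)[OF f(1), of b]]
      by (simp add: distrib_right)
  next
    fix a :: 'k and v w assume "v \<in> carrier M" "w \<in> carrier M"
    then obtain f g where fg: "f \<in> S" "g \<in> S" "v = \<Phi> f" "w = \<Phi> g" using ex by metis
    show "a \<odot>\<^bsub>M\<^esub> (v \<oplus>\<^bsub>M\<^esub> w) = a \<odot>\<^bsub>M\<^esub> v \<oplus>\<^bsub>M\<^esub> a \<odot>\<^bsub>M\<^esub> w"
      using D(4)[OF fg(1,2)] D(5)[OF C(2)[OF fg(1,2)], of a] D(5)[OF fg(1), of a]
        D(5)[OF fg(2), of a] D(4)[OF C(3)[OF fg(1), of a] C(3)[OF fg(2), of a]] fg
      by (simp add: distrib_left)
  qed
qed

lemma linear_onto_vectorspace: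
  "linear_onto S M \<Phi> \<Longrightarrow> vectorspace class_ring M"
  by (simp add: vectorspace_def linear_onto_module class_field)

lemma linear_onto_id: "lin_closed S \<Longrightarrow> linear_onto S (fun_space S) (\<lambda>f. f)"
  by (simp add: linear_onto_def)

lemma submodule_image:
  assumes "linear_onto S M \<Phi>" "lin_closed S'" "S' \<subseteq> S"
  shows "submodule class_ring (\<Phi> ` S') M"
proof -
  note D = linear_ontoD[OF assms(1)] and C = lin_closedD[OF assms(2)]
  show ?thesis
  proof (rule submodule.intro)
    show "\<Phi> ` S' \<subseteq> carrier M" using D(2) assms(3) by blast
    show "\<zero>\<^bsub>M\<^esub> \<in> \<Phi> ` S'" using C(1) D(3) by (metis imageI)
  next
    fix v w assume "v \<in> \<Phi> ` S'" "w \<in> \<Phi> ` S'"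
    then obtain f g where "f \<in> S'" "g \<in> S'" "v = \<Phi> f" "w = \<Phi> g" by blast
    then show "v \<oplus>\<^bsub>M\<^esub> w \<in> \<Phi> ` S'"
      using D(4)[of f g] C(2)[of f g] assms(3) by (metis imageI subsetD)
  next
    fix c v assume "v \<in> \<Phi> ` S'"
    then obtain f where "f \<in> S'" "v = \<Phi> f" by blast
    then show "c \<odot>\<^bsub>M\<^esub> v \<in> \<Phi> ` S'"
      using D(5)[of f c] C(3)[of f c] assms(3) by (metis imageI subsetD)
  qed (rule linear_onto_module[OF assms(1)])
qed

lemma linear_onto_kernel_lin_closed:
  assumes "linear_onto S M \<Phi>"
  shows "lin_closed {f \<in> S. \<Phi> f = \<zero>\<^bsub>M\<^esub>}"
proof -
  note D = linear_ontoD[OF assms] and C = lin_closedD[OF linear_ontoD(1)[OF assms]]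
  interpret module class_ring M by (rule linear_onto_module[OF assms])
  show ?thesis
    unfolding lin_closed_def using C(1-3) D(3-5) smult_r_null by simp
qed

lemma linear_onto_cong:
  assumes "carrier M = carrier M'" "zero M = zero M'" "add M = add M'" "smult M = smult M'"
  shows "linear_onto S M \<Phi> = linear_onto S M' \<Phi>"
  using assms by (simp add: linear_onto_def)

lemma linear_onto_restrict:
  assumes "linear_onto S M \<Phi>" "lin_closed S'" "S' \<subseteq> S"
  shows "linear_onto S' (M\<lparr>carrier := \<Phi> ` S'\<rparr>) \<Phi>"
  using assms(2) linear_ontoD(3-5)[OF assms(1)] subsetD[OF assms(3)] by (simp add: linear_onto_def)

definition fdim :: "('x \<Rightarrow> 'k::field) set \<Rightarrow> nat" where
  "fdim S = vectorspace.dim class_ring (fun_space S)"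

text \<open>A common finite support for all members makes \<open>S\<close> finite-dimensional, and this form is
  inherited by subspaces for trivial reasons.\<close>

definition fin_supp_space :: "('x \<Rightarrow> 'k::field) set \<Rightarrow> bool" where
  "fin_supp_space S \<longleftrightarrow> lin_closed S \<and> (\<exists>X. finite X \<and> (\<forall>f\<in>S. \<forall>x. f x \<noteq> 0 \<longrightarrow> x \<in> X))"

lemma subspace_fun_space:
  assumes "lin_closed S" "lin_closed S'" "S' \<subseteq> S"
  shows "subspace class_ring S' (fun_space S)" "submodule class_ring S' (fun_space S)"
proof -
  show 2: "submodule class_ring S' (fun_space S)"
    using assms lin_closedD[OF assms(2)]
    by (auto simp: submodule_def linear_onto_module[OF linear_onto_id])
  show "subspace class_ring S' (fun_space S)"
    using 2 by (simp add: subspace_def linear_onto_vectorspace[OF linear_onto_id] assms)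
qed

lemma full_fun_space_fin_dim:
  assumes "finite X"
  shows "vectorspace.fin_dim class_ring (fun_space {f :: 'x \<Rightarrow> 'k::field. \<forall>x. f x \<noteq> 0 \<longrightarrow> x \<in> X})"
    (is "vectorspace.fin_dim _ (fun_space ?S)")
proof -
  have lc: "lin_closed ?S" by (auto simp: lin_closed_def) (metis add_0)
  interpret vectorspace class_ring "fun_space ?S"
    by (rule linear_onto_vectorspace[OF linear_onto_id[OF lc]])
  let ?\<delta> = "\<lambda>w x. if x = w then 1 else (0::'k)"
  have \<delta>: "?\<delta> ` X \<subseteq> ?S" by (auto split: if_splits)
  have sub: "submodule class_ring (span (?\<delta> ` X)) (fun_space ?S)"
    using \<delta> by (intro span_is_submodule) simp
  have own: "?\<delta> ` X \<subseteq> span (?\<delta> ` X)" using \<delta> by (intro in_own_span) simp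
  have "f \<in> span (?\<delta> ` X)" if "\<forall>x. f x \<noteq> 0 \<longrightarrow> x \<in> Y" "Y \<subseteq> X" for f Y
    using finite_subset[OF that(2) assms] that
  proof (induction Y arbitrary: f rule: finite_induct)
    case empty
    then have "f = (\<lambda>_. 0)" by auto
    then show ?case using submodule.zero_closed[OF sub] by simp
  next
    case (insert w Y)
    have "f(w := 0) \<in> span (?\<delta> ` X)" using insert.prems by (intro insert.IH) auto
    moreover have "(\<lambda>x. f w * ?\<delta> w x) \<in> span (?\<delta> ` X)"
      using submodule.smult_closed[OF sub, of "f w" "?\<delta> w"] own insert.prems by fastforce
    ultimately have "(\<lambda>x. (f(w := 0)) x + f w * ?\<delta> w x) \<in> span (?\<delta> ` X)"
      using submodule.m_closed[OF sub, of "f(w := 0)" "\<lambda>x. f w * ?\<delta> w x"] by simp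
    also have "(\<lambda>x. (f(w := 0)) x + f w * ?\<delta> w x) = f" by auto
    finally show ?case .
  qed
  then have "?S \<subseteq> span (?\<delta> ` X)" by blast
  then have "span (?\<delta> ` X) = ?S" using submodule.subset[OF sub] by auto
  then show ?thesis unfolding fin_dim_def
    using assms \<delta> by (intro exI[of _ "?\<delta> ` X"]) auto
qed

text \<open>Independent subsets of \<open>N\<close> are independent in \<open>V\<close>, so their sizes are bounded and a maximal
  one exists; it generates \<open>N\<close>.\<close>

lemma (in vectorspace) subspace_fin_dim:
  assumes "fin_dim" "subspace K N V"
  shows "vectorspace.fin_dim K (vs N)"
proof -
  interpret N: vectorspace K "vs N" using assms(2) by (rule subspace_is_vs)
  have sub: "submodule K N V" using assms(2) by simp
  have NV: "N \<subseteq> carrier V" using sub by (rule submodule.subset)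
  have li: "finite A \<and> card A \<le> dim" if "A \<subseteq> N \<and> N.lin_indpt A" for A
    using that li_le_dim[OF assms(1), of A] NV span_li_not_depend(2)[of A N] sub by auto
  have "N.lin_indpt {}" by (simp add: N.lin_dep_def)
  then obtain A where "finite A" "maximal A (\<lambda>A. A \<subseteq> N \<and> N.lin_indpt A)"
    using maximal_exists[of "\<lambda>A. A \<subseteq> N \<and> N.lin_indpt A" dim "{}"] li by auto
  moreover from this have "N.gen_set A" by (intro N.max_li_is_gen) simp
  ultimately show ?thesis unfolding N.fin_dim_def by (auto simp: maximal_def)
qed

lemma fin_supp_space_fin_dim:
  assumes "fin_supp_space S"
  shows "vectorspace.fin_dim class_ring (fun_space S)"
proof -
  obtain X where X: "finite X" "\<forall>f\<in>S. \<forall>x. f x \<noteq> 0 \<longrightarrow> x \<in> X" and S: "lin_closed S"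
    using assms by (auto simp: fin_supp_space_def)
  let ?S = "{f :: 'a \<Rightarrow> 'b. \<forall>x. f x \<noteq> 0 \<longrightarrow> x \<in> X}"
  have lc: "lin_closed ?S" by (auto simp: lin_closed_def) (metis add_0)
  have "S \<subseteq> ?S" using X by auto
  then have "subspace class_ring S (fun_space ?S)" using subspace_fun_space[OF lc S] by simp
  then show ?thesis
    using vectorspace.subspace_fin_dim[OF linear_onto_vectorspace[OF linear_onto_id[OF lc]]
        full_fun_space_fin_dim[OF X(1)]] by simp
qed

lemma fdim_mono:
  assumes "fin_supp_space S" "lin_closed S'" "S' \<subseteq> S"
  shows "fdim S' \<le> fdim S"
proof -
  have S: "lin_closed S" and S': "fin_supp_space S'"
    using assms by (auto simp: fin_supp_space_def)
  show ?thesis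
    using vectorspace.subspace_dim[OF linear_onto_vectorspace[OF linear_onto_id[OF S]]
        subspace_fun_space(1)[OF S assms(2,3)]]
      fin_supp_space_fin_dim[OF assms(1)] fin_supp_space_fin_dim[OF S']
    by (simp add: fdim_def)
qed

lemma fin_supp_space_mono:
  "fin_supp_space S \<Longrightarrow> lin_closed S' \<Longrightarrow> S' \<subseteq> S \<Longrightarrow> fin_supp_space S'"
  by (auto simp: fin_supp_space_def)

text \<open>The working form of rank-nullity: the dimension of an abstract quotient is a difference of
  dimensions of concrete function spaces.\<close>

lemma linear_onto_rank_nullity:
  fixes M :: "('k::field, 'a, 'm) module_scheme"
  assumes "linear_onto S M \<Phi>" "fin_supp_space S"
  shows "vectorspace.dim class_ring M + fdim {f \<in> S. \<Phi> f = \<zero>\<^bsub>M\<^esub>} = fdim S"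
proof -
  note D = linear_ontoD[OF assms(1)]
  interpret V: vectorspace class_ring "fun_space S"
    by (rule linear_onto_vectorspace[OF linear_onto_id[OF D(1)]])
  interpret W: vectorspace class_ring M
    by (rule linear_onto_vectorspace[OF assms(1)])
  have hom: "\<Phi> \<in> module_hom class_ring (fun_space S) M"
    using D by (auto simp: module_hom_def)
  interpret lm: linear_map class_ring "fun_space S" M \<Phi>
    by unfold_locales (rule hom)
  have ker: "lm.kerT = {f \<in> S. \<Phi> f = \<zero>\<^bsub>M\<^esub>}" by (simp add: lm.ker_def)
  have im: "lm.imT = carrier M" using D(2) by (simp add: lm.im_def)
  have Mself: "M\<lparr>carrier := carrier M\<rparr> = M" by simp
  show ?thesis
    using lm.rank_nullity[OF fin_supp_space_fin_dim[OF assms(2)]]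
    unfolding ker im Mself by (simp add: fdim_def)
qed

lemma fdim_zero: "fdim {\<lambda>_. 0 :: 'k::field} = 0"
proof -
  have lc: "lin_closed {\<lambda>_. 0 :: 'k}" by (simp add: lin_closed_def)
  then have "fin_supp_space {\<lambda>_. 0 :: 'k}" by (auto simp: fin_supp_space_def)
  from linear_onto_rank_nullity[OF linear_onto_id[OF lc] this] show ?thesis by (simp add: fdim_def)
qed

text \<open>Passing to initial forms does not lower the dimension. Filter by the rank \<open>r\<close>, and let
  \<open>F R p\<close> be the members of \<open>R\<close> supported in rank at least \<open>p\<close>. The hypothesis says that the
  rank-\<open>p\<close> part of a member of \<open>F S p\<close>, rescaled by the nowhere vanishing \<open>c\<close>, lies in \<open>Q\<close>.
  Hence each graded piece of \<open>S\<close> embeds into the corresponding graded piece of \<open>Q\<close>, and the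
  dimensions of the pieces add up to \<open>dim S\<close> on one side and to at most \<open>dim Q\<close> on the other.\<close>

lemma fdim_filtration_le:
  fixes S Q :: "('x \<Rightarrow> 'k::field) set" and r :: "'x \<Rightarrow> nat"
  assumes S: "fin_supp_space S" and Q: "fin_supp_space Q" and c: "\<And>x. c x \<noteq> 0"
    and lead: "\<And>p f. f \<in> S \<Longrightarrow> (\<And>x. f x \<noteq> 0 \<Longrightarrow> p \<le> r x) \<Longrightarrow>
      (\<lambda>x. if r x = p then c x * f x else 0) \<in> Q"
  shows "fdim S \<le> fdim Q"
proof -
  define F where "F R p = {f \<in> R. \<forall>x. f x \<noteq> 0 \<longrightarrow> p \<le> r x}" for R :: "('x \<Rightarrow> 'k) set" and p
  define tr where "tr p f = (\<lambda>x. if r x = p then f x else 0)" for p and f :: "'x \<Rightarrow> 'k"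
  have lcF: "lin_closed (F R p)" if "lin_closed R" for R p
    unfolding lin_closed_def F_def using lin_closedD[OF that] by (auto, metis add_0)
  have fsF: "fin_supp_space (F R p)" if "fin_supp_space R" for R p
    by (rule fin_supp_space_mono[OF that]) (use that lcF in \<open>auto simp: fin_supp_space_def F_def\<close>)
  have ontoF: "linear_onto (F R p) (fun_space (tr p ` F R p)) (tr p)" if "lin_closed R" for R p
    using lcF[OF that] by (auto simp: linear_onto_def tr_def fun_eq_iff)
  have lc: "lin_closed S" "lin_closed Q" using S Q by (auto simp: fin_supp_space_def)
  have fdim_step: "fdim (F R p) = fdim (tr p ` F R p) + fdim (F R (Suc p))" if "fin_supp_space R" for R p
  proof -
    have "{f \<in> F R p. tr p f = (\<lambda>_. 0)} = F R (Suc p)"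
      by (auto simp: F_def tr_def fun_eq_iff Suc_le_eq order.strict_iff_order)
    then show ?thesis
      using linear_onto_rank_nullity[OF ontoF[of R p] fsF[OF that]] that
      by (simp add: fdim_def fin_supp_space_def)
  qed
  have graded: "fdim (tr p ` F S p) \<le> fdim (tr p ` F Q p)" for p
  proof -
    let ?I = "tr p ` F S p" and ?sc = "\<lambda>g x. c x * g x"
    have sub: "submodule class_ring (tr p ` F R p) (fun_space (tr p ` F R p))"
      if "lin_closed R" for R
      using submodule_image[OF ontoF[OF that] lcF[OF that], of p] by simp
    have lcI: "lin_closed (tr p ` F R p)" if "lin_closed R" for R
      using submodule.m_closed[OF sub[OF that]] submodule.zero_closed[OF sub[OF that]]
        submodule.smult_closed[OF sub[OF that]] by (simp add: lin_closed_def)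
    have fsI: "fin_supp_space (tr p ` F R p)" if R: "fin_supp_space R" for R
    proof -
      obtain X where "finite X" "\<forall>f\<in>R. \<forall>x. f x \<noteq> 0 \<longrightarrow> x \<in> X"
        using R by (auto simp: fin_supp_space_def)
      then show ?thesis using lcI[of R] R
        unfolding fin_supp_space_def by (auto simp: F_def tr_def intro!: exI[of _ X])
    qed
    have onto: "linear_onto ?I (fun_space (?sc ` ?I)) ?sc"
      using lcI[OF lc(1)] by (auto simp: linear_onto_def algebra_simps)
    have "{g \<in> ?I. ?sc g = (\<lambda>_. 0)} = {\<lambda>_. 0}"
      using c lin_closedD(1)[OF lcI[OF lc(1)]] by (auto simp: fun_eq_iff)
    then have "fdim ?I = fdim (?sc ` ?I)"
      using linear_onto_rank_nullity[OF onto fsI[OF S]] fdim_zero[where ?'a = 'x and ?'k = 'k]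
      by (simp add: fdim_def)
    also have "\<dots> \<le> fdim (tr p ` F Q p)"
    proof (rule fdim_mono[OF fsI[OF Q]])
      have "submodule class_ring (?sc ` ?I) (fun_space (?sc ` ?I))"
        using submodule_image[OF onto lcI[OF lc(1)]] by simp
      then show "lin_closed (?sc ` ?I)"
        unfolding lin_closed_def submodule_def by simp
      show "?sc ` ?I \<subseteq> tr p ` F Q p"
      proof
        fix h assume "h \<in> ?sc ` ?I"
        then obtain f where f: "f \<in> F S p" "h = ?sc (tr p f)" by blast
        have "(\<lambda>x. if r x = p then c x * f x else 0) \<in> Q"
          using f(1) by (intro lead) (auto simp: F_def)
        moreover have "h = (\<lambda>x. if r x = p then c x * f x else 0)"
          using f(2) by (auto simp: tr_def fun_eq_iff)
        ultimately have "h \<in> F Q p" by (auto simp: F_def)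
        moreover have "h = tr p h" using f(2) by (auto simp: tr_def fun_eq_iff)
        ultimately show "h \<in> tr p ` F Q p" by (metis imageI)
      qed
    qed
    finally show ?thesis .
  qed
  obtain X where X: "finite X" "\<forall>f\<in>S. \<forall>x. f x \<noteq> 0 \<longrightarrow> x \<in> X"
    using S by (auto simp: fin_supp_space_def)
  \<comment> \<open>any bound on the ranks that occur in \<open>S\<close>\<close>
  define N where "N = Suc (sum r X)"
  have "F S N = {\<lambda>_. 0}"
  proof -
    have "f x = 0" if "f \<in> F S N" for f x
    proof (rule ccontr)
      assume "f x \<noteq> 0"
      then have "x \<in> X" "N \<le> r x" using that X(2) by (auto simp: F_def)
      then show False using member_le_sum[of x X r] X(1) by (simp add: N_def)
    qed
    then show ?thesis using lin_closedD(1)[OF lcF[OF lc(1)]] by (auto simp: fun_eq_iff)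
  qed
  then have top: "fdim (F S N) \<le> fdim (F Q N)" using fdim_zero[where ?'a = 'x and ?'k = 'k] by simp
  have "fdim (F S p) \<le> fdim (F Q p)" if "p \<le> N" for p
    using that
  proof (induction rule: inc_induct)
    case base
    show ?case by (rule top)
  next
    case (step m)
    then show ?case using fdim_step[of S m] fdim_step[of Q m] graded[of m] S Q by simp
  qed
  from this[of 0] show ?thesis by (simp add: F_def)
qed

section \<open>Quotients of presented spaces\<close>

lemma quot_space_simps [simp]:
  "carrier (quot_space M N) = a_rcosets\<^bsub>M\<^esub> N"
  "zero (quot_space M N) = N"
  "add (quot_space M N) = set_add M"
  "smult (quot_space M N) = (\<lambda>c X. N <+>\<^bsub>M\<^esub> ((\<lambda>x. c \<odot>\<^bsub>M\<^esub> x) ` X))"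
  by (simp_all add: quot_space_def ring.extend_def module.fields_def FactRing_def)

lemma quot_algebra_simps [simp]:
  "carrier (quot_algebra A I) = a_rcosets\<^bsub>A\<^esub> I"
  "zero (quot_algebra A I) = I"
  "add (quot_algebra A I) = set_add A"
  "smult (quot_algebra A I) = (\<lambda>c X. I <+>\<^bsub>A\<^esub> ((\<lambda>x. c \<odot>\<^bsub>A\<^esub> x) ` X))"
  "mult (quot_algebra A I) = rcoset_mult A I"
  "one (quot_algebra A I) = I +>\<^bsub>A\<^esub> \<one>\<^bsub>A\<^esub>"
  "grade (quot_algebra A I) n = (\<lambda>a. I +>\<^bsub>A\<^esub> a) ` grade A n"
  by (simp_all add: quot_algebra_def quot_space_def ring.extend_def module.fields_def FactRing_def
      module.extend_def graded_algebra.fields_def)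

text \<open>The coset map stays linear for the scalar action of \<^const>\<open>quot_space\<close>, including \<open>c = 0\<close>,
  where \<open>N + 0 \<cdot> (N + x) = N\<close>.\<close>

lemma linear_onto_quotient:
  assumes onto: "linear_onto S M \<Phi>" and sub: "submodule class_ring N M"
  shows "linear_onto S (quot_space M N) (\<lambda>f. N +>\<^bsub>M\<^esub> \<Phi> f)"
    and "f \<in> S \<Longrightarrow> N +>\<^bsub>M\<^esub> \<Phi> f = N \<longleftrightarrow> \<Phi> f \<in> N"
proof -
  note D = linear_ontoD[OF onto]
  interpret module class_ring M by (rule linear_onto_module[OF onto])
  interpret N: submodule class_ring N M by (rule sub)
  have grp: "subgroup N (add_monoid M)"
  proof (rule add.subgroupI)
    fix a assume a: "a \<in> N"
    then have "(-1) \<odot>\<^bsub>M\<^esub> a = \<ominus>\<^bsub>M\<^esub> a"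
      using smult_minus_1[of a] N.subset by (auto simp: class_ring_simps)
    moreover have "(-1) \<odot>\<^bsub>M\<^esub> a \<in> N" using a by (intro N.smult_closed) simp_all
    ultimately show "\<ominus>\<^bsub>M\<^esub> a \<in> N" by simp
  next
    show "N \<noteq> {}" using N.zero_closed by blast
  qed (use N.subset in auto)
  interpret N: abelian_subgroup N M
    by (intro abelian_subgroupI3 additive_subgroupI grp abelian_group_axioms)
  have sm: "N <+>\<^bsub>M\<^esub> (\<lambda>x. c \<odot>\<^bsub>M\<^esub> x) ` (N +>\<^bsub>M\<^esub> x) = N +>\<^bsub>M\<^esub> (c \<odot>\<^bsub>M\<^esub> x)"
    if x: "x \<in> carrier M" for c x
  proof (intro equalityI subsetI)
    fix y assume "y \<in> N <+>\<^bsub>M\<^esub> (\<lambda>x. c \<odot>\<^bsub>M\<^esub> x) ` (N +>\<^bsub>M\<^esub> x)"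
    then obtain n n' where n: "n \<in> N" "n' \<in> N" "y = n \<oplus>\<^bsub>M\<^esub> c \<odot>\<^bsub>M\<^esub> (n' \<oplus>\<^bsub>M\<^esub> x)"
      by (auto simp: set_add_def' a_r_coset_def')
    then have c: "n \<in> carrier M" "n' \<in> carrier M" using N.subset by auto
    have "y = (n \<oplus>\<^bsub>M\<^esub> c \<odot>\<^bsub>M\<^esub> n') \<oplus>\<^bsub>M\<^esub> c \<odot>\<^bsub>M\<^esub> x"
      using n(3) c x by (simp add: smult_r_distr a_assoc)
    moreover have "n \<oplus>\<^bsub>M\<^esub> c \<odot>\<^bsub>M\<^esub> n' \<in> N" using n by simp
    ultimately show "y \<in> N +>\<^bsub>M\<^esub> (c \<odot>\<^bsub>M\<^esub> x)" by (auto simp: a_r_coset_def')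
  next
    fix y assume "y \<in> N +>\<^bsub>M\<^esub> (c \<odot>\<^bsub>M\<^esub> x)"
    then obtain n where n: "n \<in> N" "y = n \<oplus>\<^bsub>M\<^esub> c \<odot>\<^bsub>M\<^esub> x"
      by (auto simp: a_r_coset_def')
    then have "y = n \<oplus>\<^bsub>M\<^esub> c \<odot>\<^bsub>M\<^esub> (\<zero>\<^bsub>M\<^esub> \<oplus>\<^bsub>M\<^esub> x)" using x by simp
    moreover have "\<zero>\<^bsub>M\<^esub> \<oplus>\<^bsub>M\<^esub> x \<in> N +>\<^bsub>M\<^esub> x"
      using N.zero_closed by (auto simp only: a_r_coset_def')
    ultimately show "y \<in> N <+>\<^bsub>M\<^esub> (\<lambda>x. c \<odot>\<^bsub>M\<^esub> x) ` (N +>\<^bsub>M\<^esub> x)"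
      using n(1) by (auto simp only: set_add_def')
  qed
  have cos: "a_rcosets\<^bsub>M\<^esub> N = (\<lambda>x. N +>\<^bsub>M\<^esub> x) ` carrier M"
    by (auto simp: A_RCOSETS_def')
  show "linear_onto S (quot_space M N) (\<lambda>f. N +>\<^bsub>M\<^esub> \<Phi> f)"
    unfolding linear_onto_def
  proof (intro conjI ballI allI)
    show "lin_closed S" by (rule D(1))
    show "(\<lambda>f. N +>\<^bsub>M\<^esub> \<Phi> f) ` S = carrier (quot_space M N)"
      using D(2) by (simp add: cos image_image[symmetric])
    show "N +>\<^bsub>M\<^esub> \<Phi> (\<lambda>_. 0) = \<zero>\<^bsub>quot_space M N\<^esub>"
      using D(3) N.a_rcos_const[OF N.zero_closed] by simp
  qed (use D(4-6) sm N.a_rcos_sum in simp_all)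
  show "N +>\<^bsub>M\<^esub> \<Phi> f = N \<longleftrightarrow> \<Phi> f \<in> N" if "f \<in> S"
    using N.a_rcos_const N.a_rcos_self[OF D(6)[OF that]] by auto
qed

section \<open>The tensor algebra\<close>

definition tensor_mult :: "('v list \<Rightarrow> 'k::field) \<Rightarrow> ('v list \<Rightarrow> 'k) \<Rightarrow> 'v list \<Rightarrow> 'k" where
  "tensor_mult f g w = (\<Sum>j\<le>length w. f (take j w) * g (drop j w))"

definition word :: "'v list \<Rightarrow> 'v list \<Rightarrow> 'k::field" where
  "word w u = (if u = w then 1 else 0)"

lemma tensor_algebra_simps [simp]:
  "zero (tensor_algebra V) = (\<lambda>_. 0)"
  "one (tensor_algebra V) = word []"
  "f \<oplus>\<^bsub>tensor_algebra V\<^esub> g = (\<lambda>w. f w + g w)"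
  "f \<otimes>\<^bsub>tensor_algebra V\<^esub> g = tensor_mult f g"
  "c \<odot>\<^bsub>tensor_algebra V\<^esub> f = (\<lambda>w. c * f w)"
  by (auto simp: tensor_algebra_def Let_def tensor_mult_def word_def fun_eq_iff)

lemma mem_tensor_algebra:
  "f \<in> carrier (tensor_algebra V) \<longleftrightarrow> finite {w. f w \<noteq> 0} \<and> (\<forall>w. f w \<noteq> 0 \<longrightarrow> w \<in> lists V)"
  by (auto simp: tensor_algebra_def Let_def)

lemma mem_grade_tensor_algebra:
  "f \<in> grade (tensor_algebra V) n \<longleftrightarrow>
     f \<in> carrier (tensor_algebra V) \<and> (\<forall>w. f w \<noteq> 0 \<longrightarrow> length w = n)"
  by (auto simp: tensor_algebra_def Let_def)

lemma word_mem [simp]: "w \<in> lists V \<Longrightarrow> word w \<in> carrier (tensor_algebra V)"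
  by (auto simp: mem_tensor_algebra word_def)

lemma tensor_mult_add_left:
  "tensor_mult (\<lambda>w. f w + g w) h = (\<lambda>w. tensor_mult f h w + tensor_mult g h w)"
  by (simp add: fun_eq_iff tensor_mult_def distrib_right sum.distrib)

lemma tensor_mult_add_right:
  "tensor_mult h (\<lambda>w. f w + g w) = (\<lambda>w. tensor_mult h f w + tensor_mult h g w)"
  by (simp add: fun_eq_iff tensor_mult_def distrib_left sum.distrib)

lemma tensor_mult_scale_left: "tensor_mult (\<lambda>w. c * f w) h = (\<lambda>w. c * tensor_mult f h w)"
  by (simp add: fun_eq_iff tensor_mult_def sum_distrib_left mult.assoc)

lemma tensor_mult_scale_right: "tensor_mult h (\<lambda>w. c * f w) = (\<lambda>w. c * tensor_mult h f w)"
  by (simp add: fun_eq_iff tensor_mult_def sum_distrib_left mult.left_commute)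

lemma tensor_mult_zero [simp]:
  "tensor_mult (\<lambda>_. 0) h = (\<lambda>_. 0)" "tensor_mult h (\<lambda>_. 0) = (\<lambda>_. 0)"
  by (simp_all add: fun_eq_iff tensor_mult_def)

lemma word_tensor_mult:
  "tensor_mult (word u) f w = (if take (length u) w = u then f (drop (length u) w) else 0)"
proof (cases "take (length u) w = u")
  case True
  then have l: "length u \<le> length w" by (metis length_take min.absorb_iff2 min.commute)
  have j: "j = length u" if "j \<le> length w" "take j w = u" for j
    using that by auto
  have "tensor_mult (word u) f w
      = (\<Sum>j\<le>length w. if j = length u then f (drop (length u) w) else 0)"
    unfolding tensor_mult_def word_def
  proof (intro sum.cong refl)
    fix i assume "i \<in> {..length w}"
    then show "(if take i w = u then 1 else 0) * f (drop i w) =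
        (if i = length u then f (drop (length u) w) else 0)"
      using j[of i] True by (cases "take i w = u") auto
  qed
  then show ?thesis using True l by simp
next
  case False
  then have "take j w \<noteq> u" if "j \<le> length w" for j using that by auto
  then show ?thesis using False by (auto simp: tensor_mult_def word_def)
qed

lemma tensor_mult_word:
  "tensor_mult f (word u) w =
     (if length u \<le> length w \<and> drop (length w - length u) w = u
      then f (take (length w - length u) w) else 0)"
proof -
  have j: "j = length w - length u" if "j \<le> length w" "drop j w = u" for j
    using that by auto
  have "tensor_mult f (word u) w
      = (\<Sum>j\<le>length w. if j = length w - length u then
           (if length u \<le> length w \<and> drop (length w - length u) w = u
            then f (take (length w - length u) w) else 0) else 0)"
    unfolding tensor_mult_def word_def
  proof (intro sum.cong refl)
    fix i assume "i \<in> {..length w}"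
    then show "f (take i w) * (if drop i w = u then 1 else 0) =
        (if i = length w - length u then
           (if length u \<le> length w \<and> drop (length w - length u) w = u
            then f (take (length w - length u) w) else 0) else 0)"
      using j[of i] by (cases "drop i w = u") auto
  qed
  then show ?thesis by simp
qed

text \<open>Both sides are the sum over all ways to cut the word at two places.\<close>

lemma tensor_mult_assoc: "tensor_mult (tensor_mult f g) h = tensor_mult f (tensor_mult g h)"
proof
  fix w :: "'a list"
  let ?n = "length w"
  let ?t = "\<lambda>i j. f (take i w) * g (drop i (take j w)) * h (drop j w)"
  have "tensor_mult (tensor_mult f g) h w = (\<Sum>j\<le>?n. \<Sum>i\<le>j. ?t i j)"
    unfolding tensor_mult_def
    by (intro sum.cong refl) (auto simp: sum_distrib_right min_def intro!: sum.cong)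
  also have "\<dots> = (\<Sum>(j, i)\<in>Sigma {..?n} (\<lambda>j. {..j}). ?t i j)"
    by (simp add: sum.Sigma)
  also have "\<dots> = (\<Sum>(i, l)\<in>Sigma {..?n} (\<lambda>i. {..?n - i}). ?t i (i + l))"
    by (rule sum.reindex_bij_witness[of _ "\<lambda>(i, l). (i + l, i)" "\<lambda>(j, i). (i, j - i)"]) auto
  also have "\<dots> = (\<Sum>i\<le>?n. \<Sum>l\<le>?n - i. ?t i (i + l))"
    by (simp add: sum.Sigma)
  also have "\<dots> = tensor_mult f (tensor_mult g h) w"
    unfolding tensor_mult_def
    by (intro sum.cong refl)
      (auto simp: sum_distrib_left mult.assoc take_drop add.commute intro!: sum.cong)
  finally show "tensor_mult (tensor_mult f g) h w = tensor_mult f (tensor_mult g h) w" .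
qed

lemma word_Nil_tensor_mult [simp]: "tensor_mult (word []) f = f" "tensor_mult f (word []) = f"
  by (simp_all add: fun_eq_iff word_tensor_mult tensor_mult_word)

lemma tensor_mult_nonzeroE:
  assumes "tensor_mult f g w \<noteq> 0"
  obtains u v where "w = u @ v" "f u \<noteq> 0" "g v \<noteq> 0"
proof -
  from assms obtain j where "f (take j w) * g (drop j w) \<noteq> 0"
    unfolding tensor_mult_def by (meson sum.neutral)
  then show thesis using that[of "take j w" "drop j w"] by auto
qed

lemma tensor_mult_closed [simp]:
  assumes "f \<in> carrier (tensor_algebra V)" "g \<in> carrier (tensor_algebra V)"
  shows "tensor_mult f g \<in> carrier (tensor_algebra V)"
proof -
  have "{w. tensor_mult f g w \<noteq> 0} \<subseteq> (\<lambda>(u, v). u @ v) ` ({w. f w \<noteq> 0} \<times> {w. g w \<noteq> 0})"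
    by (force elim: tensor_mult_nonzeroE)
  then have "finite {w. tensor_mult f g w \<noteq> 0}"
    using assms unfolding mem_tensor_algebra
    by (elim conjE) (erule finite_subset, intro finite_imageI finite_cartesian_product)
  moreover have "w \<in> lists V" if nz: "tensor_mult f g w \<noteq> 0" for w
    using nz assms by (elim tensor_mult_nonzeroE) (auto simp: mem_tensor_algebra)
  ultimately show ?thesis by (simp add: mem_tensor_algebra)
qed

lemma tensor_mult_grade:
  assumes "f \<in> grade (tensor_algebra V) m" "g \<in> grade (tensor_algebra V) n"
  shows "tensor_mult f g \<in> grade (tensor_algebra V) (m + n)"
proof -
  have "length w = m + n" if nz: "tensor_mult f g w \<noteq> 0" for w
    using nz assms by (elim tensor_mult_nonzeroE) (auto simp: mem_grade_tensor_algebra)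
  then show ?thesis using assms by (simp add: mem_grade_tensor_algebra)
qed

lemma lin_closed_tensor_algebra:
  fixes V :: "'v set"
  shows "lin_closed (carrier (tensor_algebra V :: ('k::field, _) graded_algebra))"
  unfolding lin_closed_def
proof (intro conjI ballI allI)
  fix f g :: "'v list \<Rightarrow> 'k" and c :: 'k
  assume f: "f \<in> carrier (tensor_algebra V)"
  have "{w. c * f w \<noteq> 0} \<subseteq> {w. f w \<noteq> 0}" by auto
  then show "(\<lambda>w. c * f w) \<in> carrier (tensor_algebra V)"
    using f unfolding mem_tensor_algebra by (auto dest: finite_subset)
  assume g: "g \<in> carrier (tensor_algebra V)"
  have "{w. f w + g w \<noteq> 0} \<subseteq> {w. f w \<noteq> 0} \<union> {w. g w \<noteq> 0}" by auto
  from finite_subset[OF this] show "(\<lambda>w. f w + g w) \<in> carrier (tensor_algebra V)"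
    using f g unfolding mem_tensor_algebra by force
qed (simp add: mem_tensor_algebra)

lemma lin_closed_grade:
  fixes V :: "'v set"
  shows "lin_closed (grade (tensor_algebra V :: ('k::field, _) graded_algebra) n)"
  unfolding lin_closed_def
proof (intro conjI ballI allI)
  fix f g :: "'v list \<Rightarrow> 'k" and c :: 'k
  assume f: "f \<in> grade (tensor_algebra V) n"
  then show "(\<lambda>w. c * f w) \<in> grade (tensor_algebra V) n"
    by (auto simp: mem_grade_tensor_algebra intro: lin_closedD(3)[OF lin_closed_tensor_algebra])
  assume g: "g \<in> grade (tensor_algebra V) n"
  have "f w \<noteq> 0 \<or> g w \<noteq> 0" if "f w + g w \<noteq> 0" for w using that by auto
  then show "(\<lambda>w. f w + g w) \<in> grade (tensor_algebra V) n"
    using f g lin_closedD(2)[OF lin_closed_tensor_algebra, of f V g]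
    unfolding mem_grade_tensor_algebra by blast
qed (simp add: mem_grade_tensor_algebra mem_tensor_algebra)

lemma fin_supp_space_grade:
  fixes V :: "'v set"
  assumes "finite V"
  shows "fin_supp_space (grade (tensor_algebra V :: ('k::field, _) graded_algebra) n)"
  unfolding fin_supp_space_def
proof (intro conjI lin_closed_grade)
  have "finite {w. set w \<subseteq> V \<and> length w = n}" by (rule finite_lists_length_eq[OF assms])
  moreover have "w \<in> {w. set w \<subseteq> V \<and> length w = n}"
    if "f \<in> grade (tensor_algebra V) n" "f w \<noteq> 0" for f :: "'v list \<Rightarrow> 'k" and w
  proof -
    have "w \<in> lists V" "length w = n"
      using that by (auto simp only: mem_grade_tensor_algebra mem_tensor_algebra)
    then show ?thesis by auto
  qed
  ultimately show "\<exists>X. finite X \<and>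
      (\<forall>f\<in>grade (tensor_algebra V) n. \<forall>x. (f :: 'v list \<Rightarrow> 'k) x \<noteq> 0 \<longrightarrow> x \<in> X)"
    by (intro exI[of _ "{w. set w \<subseteq> V \<and> length w = n}"]) simp
qed

section \<open>Algebras presented by the tensor algebra\<close>

text \<open>As for \<^const>\<open>linear_onto\<close>, the axioms of \<open>A\<close> are a consequence, so that a construction is known
  to be a ring as soon as it is presented by words.\<close>

definition algebra_onto ::
    "'v set \<Rightarrow> ('k::field, 'a, 'm) graded_algebra_scheme \<Rightarrow> (('v list \<Rightarrow> 'k) \<Rightarrow> 'a) \<Rightarrow> bool" where
  "algebra_onto V A \<Phi> \<longleftrightarrow>
     linear_onto (carrier (tensor_algebra V)) A \<Phi> \<and> \<Phi> (word []) = \<one>\<^bsub>A\<^esub> \<and>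
     (\<forall>f\<in>carrier (tensor_algebra V). \<forall>g\<in>carrier (tensor_algebra V).
        \<Phi> (tensor_mult f g) = \<Phi> f \<otimes>\<^bsub>A\<^esub> \<Phi> g) \<and>
     (\<forall>n. \<Phi> ` grade (tensor_algebra V) n = grade A n)"

lemma algebra_ontoD:
  assumes "algebra_onto V A \<Phi>"
  shows "linear_onto (carrier (tensor_algebra V)) A \<Phi>" "\<Phi> (word []) = \<one>\<^bsub>A\<^esub>"
    and "f \<in> carrier (tensor_algebra V) \<Longrightarrow> g \<in> carrier (tensor_algebra V) \<Longrightarrow>
      \<Phi> (tensor_mult f g) = \<Phi> f \<otimes>\<^bsub>A\<^esub> \<Phi> g"
    and "\<Phi> ` grade (tensor_algebra V) n = grade A n"
  using assms by (auto simp: algebra_onto_def)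

lemma algebra_onto_id: "algebra_onto V (tensor_algebra V) (\<lambda>f. f)"
  by (simp add: algebra_onto_def linear_onto_def lin_closed_tensor_algebra)

lemma algebra_onto_ring:
  fixes A :: "('k::field, 'a, 'm) graded_algebra_scheme" and \<Phi> :: "('v list \<Rightarrow> 'k) \<Rightarrow> 'a"
  assumes "algebra_onto V A \<Phi>"
  shows "ring A"
proof -
  note D = linear_ontoD[OF algebra_ontoD(1)[OF assms]] and M = algebra_ontoD(2,3)[OF assms]
  have add: "\<And>f g :: 'v list \<Rightarrow> 'k. f \<in> carrier (tensor_algebra V) \<Longrightarrow> g \<in> carrier (tensor_algebra V) \<Longrightarrow>
      (\<lambda>x. f x + g x) \<in> carrier (tensor_algebra V)"
    by (rule lin_closedD(2)[OF D(1)])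
  have ex: "\<exists>f\<in>carrier (tensor_algebra V). x = \<Phi> f" if "x \<in> carrier A" for x
    using that D(2) by blast
  interpret module class_ring A
    by (rule linear_onto_module[OF algebra_ontoD(1)[OF assms]])
  show ?thesis
  proof (rule ringI[OF abelian_group_axioms monoidI])
    show "\<one>\<^bsub>A\<^esub> \<in> carrier A" using D(6)[of "word []"] M(1) by simp
  next
    fix x y assume "x \<in> carrier A" "y \<in> carrier A"
    then obtain f g where *: "f \<in> carrier (tensor_algebra V)" "g \<in> carrier (tensor_algebra V)"
        "x = \<Phi> f" "y = \<Phi> g"
      using ex by metis
    show "x \<otimes>\<^bsub>A\<^esub> y \<in> carrier A"
      using M(2)[OF *(1,2)] D(6)[OF tensor_mult_closed[OF *(1,2)]] * by simp
  next
    fix x y z assume "x \<in> carrier A" "y \<in> carrier A" "z \<in> carrier A"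
    then obtain f g h where *: "f \<in> carrier (tensor_algebra V)" "g \<in> carrier (tensor_algebra V)"
        "h \<in> carrier (tensor_algebra V)" "x = \<Phi> f" "y = \<Phi> g" "z = \<Phi> h"
      using ex by metis
    note c = *(1-3) and e = *(4-6)
    show "x \<otimes>\<^bsub>A\<^esub> y \<otimes>\<^bsub>A\<^esub> z = x \<otimes>\<^bsub>A\<^esub> (y \<otimes>\<^bsub>A\<^esub> z)"
      unfolding e using c by (simp add: M(2)[symmetric] tensor_mult_assoc)
    show "(x \<oplus>\<^bsub>A\<^esub> y) \<otimes>\<^bsub>A\<^esub> z = x \<otimes>\<^bsub>A\<^esub> z \<oplus>\<^bsub>A\<^esub> y \<otimes>\<^bsub>A\<^esub> z"
      unfolding e using c
      by (simp add: M(2)[symmetric] D(4)[symmetric] tensor_mult_add_left add)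
    show "z \<otimes>\<^bsub>A\<^esub> (x \<oplus>\<^bsub>A\<^esub> y) = z \<otimes>\<^bsub>A\<^esub> x \<oplus>\<^bsub>A\<^esub> z \<otimes>\<^bsub>A\<^esub> y"
      unfolding e using c
      by (simp add: M(2)[symmetric] D(4)[symmetric] tensor_mult_add_right add)
  next
    fix x assume "x \<in> carrier A"
    then obtain f where *: "f \<in> carrier (tensor_algebra V)" "x = \<Phi> f" using ex by metis
    show "\<one>\<^bsub>A\<^esub> \<otimes>\<^bsub>A\<^esub> x = x" "x \<otimes>\<^bsub>A\<^esub> \<one>\<^bsub>A\<^esub> = x"
      unfolding *(2) M(1)[symmetric] using *(1) by (simp_all add: M(2)[symmetric])
  qed
qed

text \<open>A ring ideal is closed under scalars because \<open>c \<cdot> x = (c \<cdot> 1) x\<close>.\<close>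

lemma algebra_onto_ideal_submodule:
  assumes "algebra_onto V A \<Phi>" "ideal I A"
  shows "submodule class_ring I A"
proof -
  note D = linear_ontoD[OF algebra_ontoD(1)[OF assms(1)]] and M = algebra_ontoD(2,3)[OF assms(1)]
  interpret ideal I A by (rule assms(2))
  have "c \<odot>\<^bsub>A\<^esub> x \<in> I" if "x \<in> I" for c x
  proof -
    obtain f where f: "f \<in> carrier (tensor_algebra V)" "x = \<Phi> f"
      using \<open>x \<in> I\<close> a_subset D(2) by blast
    have c: "(\<lambda>w. c * word [] w) \<in> carrier (tensor_algebra V)"
      by (rule lin_closedD(3)[OF D(1)]) simp
    have "c \<odot>\<^bsub>A\<^esub> x = \<Phi> (tensor_mult (\<lambda>w. c * word [] w) f)"
      using D(5)[OF f(1), of c] f(2) by (simp add: tensor_mult_scale_left)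
    also have "\<dots> = \<Phi> (\<lambda>w. c * word [] w) \<otimes>\<^bsub>A\<^esub> x"
      using M(2)[OF c f(1)] f(2) by simp
    also have "\<dots> \<in> I" using I_l_closed[OF that D(6)[OF c]] .
    finally show ?thesis .
  qed
  then show ?thesis
    using a_subset linear_onto_module[OF algebra_ontoD(1)[OF assms(1)]]
    by (simp add: submodule_def)
qed

lemma algebra_onto_quotient:
  assumes "algebra_onto V A \<Phi>" "ideal I A"
  shows "algebra_onto V (quot_algebra A I) (\<lambda>f. I +>\<^bsub>A\<^esub> \<Phi> f)"
proof -
  note D = linear_ontoD[OF algebra_ontoD(1)[OF assms(1)]] and M = algebra_ontoD(2,3,4)[OF assms(1)]
  have 1: "linear_onto (carrier (tensor_algebra V)) (quot_algebra A I) (\<lambda>f. I +>\<^bsub>A\<^esub> \<Phi> f)"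
    using linear_onto_quotient(1)[OF algebra_ontoD(1)[OF assms(1)]
        algebra_onto_ideal_submodule[OF assms]]
    by (subst linear_onto_cong[of _ "quot_space A I"]) simp_all
  have "(\<lambda>f. I +>\<^bsub>A\<^esub> \<Phi> f) ` grade (tensor_algebra V) n = grade (quot_algebra A I) n" for n
    by (simp add: M(3)[symmetric] image_image)
  then show ?thesis
    using 1 D(6) M(1,2) ideal.rcoset_mult_add[OF assms(2)] by (simp add: algebra_onto_def)
qed

definition tensor_ideal :: "'v set \<Rightarrow> ('v list \<Rightarrow> 'k::field) set \<Rightarrow> bool" where
  "tensor_ideal V K \<longleftrightarrow> lin_closed K \<and> K \<subseteq> carrier (tensor_algebra V) \<and>
     (\<forall>f\<in>K. \<forall>g\<in>carrier (tensor_algebra V). tensor_mult f g \<in> K \<and> tensor_mult g f \<in> K)"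

lemma algebra_onto_kernel:
  assumes "algebra_onto V A \<Phi>"
  shows "tensor_ideal V {f \<in> carrier (tensor_algebra V). \<Phi> f = \<zero>\<^bsub>A\<^esub>}"
proof -
  interpret ring A by (rule algebra_onto_ring[OF assms])
  note D = linear_ontoD[OF algebra_ontoD(1)[OF assms]]
  show ?thesis
    using linear_onto_kernel_lin_closed[OF algebra_ontoD(1)[OF assms]] D(6)
      algebra_ontoD(3)[OF assms]
    by (auto simp: tensor_ideal_def)
qed

lemma algebra_onto_image_ideal:
  assumes onto: "algebra_onto V A \<Phi>" and K: "tensor_ideal V K"
  shows "ideal (\<Phi> ` K) A"
proof -
  note D = linear_ontoD[OF algebra_ontoD(1)[OF onto]]
  have lc: "lin_closed K" and sub: "K \<subseteq> carrier (tensor_algebra V)"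
    and mul: "\<And>f g. f \<in> K \<Longrightarrow> g \<in> carrier (tensor_algebra V) \<Longrightarrow>
      tensor_mult f g \<in> K \<and> tensor_mult g f \<in> K"
    using K by (auto simp: tensor_ideal_def)
  interpret module class_ring A by (rule linear_onto_module[OF algebra_ontoD(1)[OF onto]])
  interpret N: submodule class_ring "\<Phi> ` K" A
    by (rule submodule_image[OF algebra_ontoD(1)[OF onto] lc sub])
  show ?thesis
  proof (rule idealI[OF algebra_onto_ring[OF onto]])
    show "subgroup (\<Phi> ` K) (add_monoid A)"
    proof (rule add.subgroupI)
      fix a assume a: "a \<in> \<Phi> ` K"
      then have "(-1) \<odot>\<^bsub>A\<^esub> a = \<ominus>\<^bsub>A\<^esub> a"
        using smult_minus_1[of a] N.subset by (auto simp: class_ring_simps)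
      moreover have "(-1) \<odot>\<^bsub>A\<^esub> a \<in> \<Phi> ` K" using a by (intro N.smult_closed) simp_all
      ultimately show "\<ominus>\<^bsub>A\<^esub> a \<in> \<Phi> ` K" by simp
    next
      show "\<Phi> ` K \<noteq> {}" using N.zero_closed by blast
      show "\<Phi> ` K \<subseteq> carrier A" by (rule N.subset)
      show "a \<oplus>\<^bsub>A\<^esub> b \<in> \<Phi> ` K" if "a \<in> \<Phi> ` K" "b \<in> \<Phi> ` K" for a b
        using that by (rule N.m_closed)
    qed
  next
    fix a x assume "a \<in> \<Phi> ` K" "x \<in> carrier A"
    then obtain f g where f: "f \<in> K" "a = \<Phi> f" and g: "g \<in> carrier (tensor_algebra V)" "x = \<Phi> g"
      using D(2) by blast
    have f': "f \<in> carrier (tensor_algebra V)" using f(1) sub by blast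
    show "x \<otimes>\<^bsub>A\<^esub> a \<in> \<Phi> ` K"
      using algebra_ontoD(3)[OF onto g(1) f'] mul[OF f(1) g(1)] f(2) g(2) by (metis imageI)
    show "a \<otimes>\<^bsub>A\<^esub> x \<in> \<Phi> ` K"
      using algebra_ontoD(3)[OF onto f' g(1)] mul[OF f(1) g(1)] f(2) g(2) by (metis imageI)
  qed
qed

section \<open>The Stanley--Reisner ideal is multihomogeneous\<close>

definition SR_map :: "'v set \<Rightarrow> 'v set set \<Rightarrow> ('v list \<Rightarrow> 'k::field) \<Rightarrow> ('v list \<Rightarrow> 'k) set set" where
  "SR_map V L f =
     SR_ideal V L +>\<^bsub>exterior_algebra V\<^esub> (exterior_ideal V +>\<^bsub>tensor_algebra V\<^esub> f)"

lemma exterior_ideal_ideal: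
  fixes V :: "'v set"
  shows "ideal (exterior_ideal V :: ('v list \<Rightarrow> 'k::field) set) (tensor_algebra V)"
  unfolding exterior_ideal_def
  by (rule ring.genideal_ideal[OF algebra_onto_ring[OF algebra_onto_id]])
    (auto simp: mem_grade_tensor_algebra)

lemma exterior_algebra_onto:
  fixes V :: "'v set"
  shows "algebra_onto V (exterior_algebra V :: ('k::field, _) graded_algebra)
    (\<lambda>f. exterior_ideal V +>\<^bsub>tensor_algebra V\<^esub> f)"
  unfolding exterior_algebra_def
  by (rule algebra_onto_quotient[OF algebra_onto_id exterior_ideal_ideal])

lemma exterior_monomial_word:
  "exterior_monomial V w = exterior_ideal V +>\<^bsub>tensor_algebra V\<^esub> word w"
  by (simp add: exterior_monomial_def word_def[abs_def])

lemma exterior_monomial_closed: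
  fixes V :: "'v set"
  assumes "w \<in> lists V"
  shows "(exterior_monomial V w :: ('v list \<Rightarrow> 'k::field) set) \<in> carrier (exterior_algebra V)"
  unfolding exterior_monomial_word
  by (rule linear_ontoD(6)[OF algebra_ontoD(1)[OF exterior_algebra_onto]]) (rule word_mem[OF assms])

lemma SR_ideal_ideal:
  fixes V :: "'v set"
  shows "ideal (SR_ideal V L :: ('v list \<Rightarrow> 'k::field) set set) (exterior_algebra V)"
  unfolding SR_ideal_def
  by (rule ring.genideal_ideal[OF algebra_onto_ring[OF exterior_algebra_onto]])
    (auto intro: exterior_monomial_closed)

lemma SR_algebra_onto:
  fixes V :: "'v set"
  shows "algebra_onto V (SR_algebra V L :: ('k::field, _) graded_algebra) (SR_map V L)"
  unfolding SR_algebra_def SR_map_def[abs_def]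
  by (rule algebra_onto_quotient[OF exterior_algebra_onto SR_ideal_ideal])

text \<open>The ideal \<open>J\<close> of the tensor algebra that presents \<open>k\<langle>L\<rangle>\<close> directly. Working with \<open>J\<close> upstairs
  avoids any choice of a basis of the quotient, hence of an order on the vertices.\<close>

definition SR_kernel :: "'v set \<Rightarrow> 'v set set \<Rightarrow> ('v list \<Rightarrow> 'k::field) set" where
  "SR_kernel V L = {f \<in> carrier (tensor_algebra V). SR_map V L f = \<zero>\<^bsub>SR_algebra V L\<^esub>}"

lemma tensor_ideal_SR_kernel: "tensor_ideal V (SR_kernel V L)"
  unfolding SR_kernel_def by (rule algebra_onto_kernel[OF SR_algebra_onto])

lemma mem_SR_kernel:
  fixes V :: "'v set" and f :: "'v list \<Rightarrow> 'k::field"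
  assumes "f \<in> carrier (tensor_algebra V)"
  shows "f \<in> SR_kernel V L \<longleftrightarrow>
    (exterior_ideal V +>\<^bsub>tensor_algebra V\<^esub> f) \<in> SR_ideal V L"
  using assms linear_onto_quotient(2)[OF algebra_ontoD(1)[OF exterior_algebra_onto]
      algebra_onto_ideal_submodule[OF exterior_algebra_onto SR_ideal_ideal], of f V L]
  by (simp add: SR_kernel_def SR_map_def SR_algebra_def)

lemma exterior_coset_zero:
  fixes V :: "'v set" and f :: "'v list \<Rightarrow> 'k::field"
  assumes "f \<in> carrier (tensor_algebra V)"
  shows "(exterior_ideal V +>\<^bsub>tensor_algebra V\<^esub> f) = exterior_ideal V \<longleftrightarrow> f \<in> exterior_ideal V"
  using linear_onto_quotient(2)[OF algebra_ontoD(1)[OF algebra_onto_id]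
      algebra_onto_ideal_submodule[OF algebra_onto_id exterior_ideal_ideal], OF assms] .

lemma square_in_SR_kernel:
  fixes V :: "'v set" and x :: "'v list \<Rightarrow> 'k::field"
  assumes "x \<in> grade (tensor_algebra V) 1"
  shows "tensor_mult x x \<in> SR_kernel V L"
proof -
  have x: "x \<in> carrier (tensor_algebra V)" using assms by (simp add: mem_grade_tensor_algebra)
  interpret T: ring "tensor_algebra V :: ('k, _) graded_algebra"
    by (rule algebra_onto_ring[OF algebra_onto_id])
  interpret I: ideal "SR_ideal V L :: ('v list \<Rightarrow> 'k) set set" "exterior_algebra V"
    by (rule SR_ideal_ideal)
  have "tensor_mult x x \<in> exterior_ideal V"
    unfolding exterior_ideal_def using assms
    by (intro subsetD[OF T.genideal_self]) (auto simp: mem_grade_tensor_algebra)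
  then have "(exterior_ideal V +>\<^bsub>tensor_algebra V\<^esub> tensor_mult x x) = exterior_ideal V"
    using exterior_coset_zero x tensor_mult_closed by blast
  also have "(exterior_ideal V :: ('v list \<Rightarrow> 'k) set) = \<zero>\<^bsub>exterior_algebra V\<^esub>" by (simp add: exterior_algebra_def)
  also have "\<dots> \<in> SR_ideal V L" by (rule additive_subgroup.zero_closed[OF I.is_additive_subgroup])
  finally show ?thesis using x by (simp add: mem_SR_kernel)
qed

lemma nonface_in_SR_kernel:
  fixes V :: "'v set"
  assumes "w \<in> lists V" "set w \<notin> L"
  shows "(word w :: 'v list \<Rightarrow> 'k::field) \<in> SR_kernel V L"
proof -
  interpret E: ring "exterior_algebra V :: ('k, _) graded_algebra"
    by (rule algebra_onto_ring[OF exterior_algebra_onto])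
  have "(exterior_monomial V w :: ('v list \<Rightarrow> 'k) set) \<in> SR_ideal V L"
    unfolding SR_ideal_def using assms
    by (intro subsetD[OF E.genideal_self]) (auto intro: exterior_monomial_closed)
  then show ?thesis using assms(1) by (simp add: mem_SR_kernel exterior_monomial_word)
qed

text \<open>The two successive quotients amount to one: \<open>J\<close> is generated by the squares of linear forms
  together with the monomials of non-faces.\<close>

lemma SR_kernel_minimal:
  fixes V :: "'v set" and K :: "('v list \<Rightarrow> 'k::field) set"
  assumes K: "tensor_ideal V K"
    and sq: "\<And>x. x \<in> grade (tensor_algebra V) 1 \<Longrightarrow> tensor_mult x x \<in> K"
    and mon: "\<And>w. w \<in> lists V \<Longrightarrow> set w \<notin> L \<Longrightarrow> word w \<in> K"
  shows "SR_kernel V L \<subseteq> K"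
proof
  let ?\<pi> = "\<lambda>f :: 'v list \<Rightarrow> 'k. exterior_ideal V +>\<^bsub>tensor_algebra V\<^esub> f"
  note D = linear_ontoD[OF algebra_ontoD(1)[OF exterior_algebra_onto[of V]]]
  have lc: "lin_closed K" and sub: "K \<subseteq> carrier (tensor_algebra V)"
    using K by (auto simp: tensor_ideal_def)
  interpret T: ring "tensor_algebra V :: ('k, _) graded_algebra"
    by (rule algebra_onto_ring[OF algebra_onto_id])
  interpret E: ring "exterior_algebra V :: ('k, _) graded_algebra"
    by (rule algebra_onto_ring[OF exterior_algebra_onto])
  have "ideal K (tensor_algebra V)" using algebra_onto_image_ideal[OF algebra_onto_id K] by simp
  then have ext: "exterior_ideal V \<subseteq> K"
    unfolding exterior_ideal_def using sq by (intro T.genideal_minimal) auto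
  have "SR_ideal V L \<subseteq> ?\<pi> ` K"
    unfolding SR_ideal_def
    by (intro E.genideal_minimal algebra_onto_image_ideal[OF exterior_algebra_onto K])
      (auto simp: exterior_monomial_word intro: mon)
  moreover fix f :: "'v list \<Rightarrow> 'k" assume f: "f \<in> SR_kernel V L"
  then have fc: "f \<in> carrier (tensor_algebra V)" by (simp add: SR_kernel_def)
  ultimately obtain k where k: "k \<in> K" "?\<pi> f = ?\<pi> k" using f by (auto simp: mem_SR_kernel)
  have kc: "k \<in> carrier (tensor_algebra V)" using k(1) sub by blast
  have mc: "(\<lambda>x. -1 * k x) \<in> carrier (tensor_algebra V)"
    by (rule lin_closedD(3)[OF lin_closed_tensor_algebra kc])
  have "?\<pi> (\<lambda>x. f x + -1 * k x) = ?\<pi> (\<lambda>x. k x + -1 * k x)"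
    using D(4)[OF fc mc] D(4)[OF kc mc] k(2) by simp
  also have "\<dots> = exterior_ideal V" using D(3) by (simp add: exterior_algebra_def)
  finally have "(\<lambda>x. f x + -1 * k x) \<in> exterior_ideal V"
    using exterior_coset_zero lin_closedD(2)[OF lin_closed_tensor_algebra fc mc] by blast
  then have "(\<lambda>x. (f x + -1 * k x) + k x) \<in> K"
    using lin_closedD(2)[OF lc] ext k(1) by blast
  then show "f \<in> K" by simp
qed

text \<open>Induction on the support. That the new word does not occur in \<open>g\<close> guarantees that both
  summands inherit homogeneity from their sum.\<close>

lemma tensor_algebra_induct:
  fixes V :: "'v set" and f :: "'v list \<Rightarrow> 'k::field"
  assumes "f \<in> carrier (tensor_algebra V)"
    and "P (\<lambda>_. 0)"
    and "\<And>c w g. w \<in> lists V \<Longrightarrow> g \<in> carrier (tensor_algebra V) \<Longrightarrow> c \<noteq> 0 \<Longrightarrow>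
      g w = 0 \<Longrightarrow> P g \<Longrightarrow> P (\<lambda>x. c * word w x + g x)"
  shows "P f"
proof -
  have "P f" if "finite Y" "\<And>w. f w \<noteq> 0 \<Longrightarrow> w \<in> Y" "f \<in> carrier (tensor_algebra V)" for f Y
    using that
  proof (induction Y arbitrary: f rule: finite_induct)
    case empty
    then have "f = (\<lambda>_. 0)" by auto
    then show ?case using assms(2) by simp
  next
    case (insert w Y)
    show ?case
    proof (cases "f w = 0")
      case True
      then show ?thesis using insert.prems by (intro insert.IH) auto
    next
      case False
      then have w: "w \<in> lists V" using insert.prems(2) by (simp add: mem_tensor_algebra)
      have g: "f(w := 0) \<in> carrier (tensor_algebra V)"
        using insert.prems(2) unfolding mem_tensor_algebra
        by (auto elim!: rev_finite_subset)
      have "P (f(w := 0))"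
        using insert.prems(1) by (intro insert.IH g) (auto split: if_splits)
      then have "P (\<lambda>x. f w * word w x + (f(w := 0)) x)" using assms(3)[OF w g False] by simp
      also have "(\<lambda>x. f w * word w x + (f(w := 0)) x) = f" by (auto simp: word_def)
      finally show ?thesis .
    qed
  qed
  from this[of "{w. f w \<noteq> 0}" f] show ?thesis using assms(1) by (simp add: mem_tensor_algebra)
qed

text \<open>Acting by a scalar on each multidegree. Both the torus action \<open>v\<^sup>* \<mapsto> q\<^sub>v v\<^sup>*\<close> and the
  projections onto sums of multigraded components are of this form.\<close>

definition reweight :: "('v multiset \<Rightarrow> 'k::field) \<Rightarrow> ('v list \<Rightarrow> 'k) \<Rightarrow> 'v list \<Rightarrow> 'k" where
  "reweight \<omega> f w = \<omega> (mset w) * f w"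

lemma reweight_closed:
  assumes "f \<in> carrier (tensor_algebra V)"
  shows "reweight \<omega> f \<in> carrier (tensor_algebra V)"
proof -
  have "{w. reweight \<omega> f w \<noteq> 0} \<subseteq> {w. f w \<noteq> 0}" by (auto simp: reweight_def)
  then show ?thesis
    using assms unfolding mem_tensor_algebra by (auto simp: reweight_def dest: finite_subset)
qed

lemma reweight_grade:
  "f \<in> grade (tensor_algebra V) n \<Longrightarrow> reweight \<omega> f \<in> grade (tensor_algebra V) n"
  by (auto simp: mem_grade_tensor_algebra reweight_closed) (auto simp: reweight_def)

lemma reweight_add: "reweight \<omega> (\<lambda>x. f x + g x) = (\<lambda>x. reweight \<omega> f x + reweight \<omega> g x)"
  by (simp add: fun_eq_iff reweight_def distrib_left)

lemma reweight_scale: "reweight \<omega> (\<lambda>x. c * f x) = (\<lambda>x. c * reweight \<omega> f x)"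
  by (simp add: fun_eq_iff reweight_def)

lemma reweight_zero [simp]: "reweight \<omega> (\<lambda>_. 0) = (\<lambda>_. 0)"
  by (simp add: fun_eq_iff reweight_def)

lemma reweight_word: "reweight \<omega> (word w) = (\<lambda>x. \<omega> (mset w) * word w x)"
  by (simp add: fun_eq_iff reweight_def word_def)

lemma reweight_word_mult:
  "reweight \<omega> (tensor_mult (word u) f) = tensor_mult (word u) (reweight (\<lambda>M. \<omega> (mset u + M)) f)"
proof
  fix w
  have "mset w = mset u + mset (drop (length u) w)" if "take (length u) w = u"
    using that by (metis append_take_drop_id mset_append)
  then show "reweight \<omega> (tensor_mult (word u) f) w =
      tensor_mult (word u) (reweight (\<lambda>M. \<omega> (mset u + M)) f) w"
    by (simp add: reweight_def word_tensor_mult)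
qed

lemma reweight_mult_word:
  "reweight \<omega> (tensor_mult f (word u)) = tensor_mult (reweight (\<lambda>M. \<omega> (M + mset u)) f) (word u)"
proof
  fix w
  have "mset w = mset (take (length w - length u) w) + mset u"
    if "drop (length w - length u) w = u"
    using that by (metis append_take_drop_id mset_append)
  then show "reweight \<omega> (tensor_mult f (word u)) w =
      tensor_mult (reweight (\<lambda>M. \<omega> (M + mset u)) f) (word u) w"
    by (simp add: reweight_def tensor_mult_word)
qed

text \<open>The square of a linear form is a combination of the multihomogeneous relations \<open>v\<^sup>*v\<^sup>*\<close> and
  \<open>v\<^sup>*w\<^sup>* + w\<^sup>*v\<^sup>*\<close>. Adding one vertex at a time produces the latter only in the form
  \<open>v\<^sup>*y + y v\<^sup>*\<close> with a linear form \<open>y\<close>; reweighting turns it into \<open>v\<^sup>*z + z v\<^sup>*\<close> for another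
  linear form \<open>z\<close>, which is the polarisation \<open>(v\<^sup>* + z)\<^sup>2 - v\<^sup>*v\<^sup>* - z\<^sup>2\<close>. This covers
  characteristic 2 and unordered vertices.\<close>

lemma reweight_square_in_SR_kernel:
  fixes V :: "'v set" and x :: "'v list \<Rightarrow> 'k::field"
  assumes "x \<in> grade (tensor_algebra V) 1"
  shows "reweight \<omega> (tensor_mult x x) \<in> SR_kernel V L"
proof -
  let ?J = "SR_kernel V L :: ('v list \<Rightarrow> 'k) set"
  let ?T1 = "grade (tensor_algebra V) 1 :: ('v list \<Rightarrow> 'k) set"
  have "lin_closed ?J" using tensor_ideal_SR_kernel[of V L] by (auto simp: tensor_ideal_def)
  note J = lin_closedD[OF this]
  note sq = square_in_SR_kernel[where V = V and L = L and ?'k = 'k]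
  have "x \<in> ?T1 \<longrightarrow> (\<forall>\<omega>. reweight \<omega> (tensor_mult x x) \<in> ?J)"
  proof (rule tensor_algebra_induct[of x V])
    show "x \<in> carrier (tensor_algebra V)" using assms by (simp add: mem_grade_tensor_algebra)
    show "(\<lambda>_. 0) \<in> ?T1 \<longrightarrow> (\<forall>\<omega>. reweight \<omega> (tensor_mult (\<lambda>_. 0) (\<lambda>_. 0)) \<in> ?J)"
      using J(1) by simp
  next
    fix c :: 'k and w and y :: "'v list \<Rightarrow> 'k"
    assume w: "w \<in> lists V" and c: "c \<noteq> 0" and y: "y \<in> carrier (tensor_algebra V)" "y w = 0"
      and IH: "y \<in> ?T1 \<longrightarrow> (\<forall>\<omega>. reweight \<omega> (tensor_mult y y) \<in> ?J)"
    show "(\<lambda>x. c * word w x + y x) \<in> ?T1 \<longrightarrow>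
      (\<forall>\<omega>. reweight \<omega> (tensor_mult (\<lambda>x. c * word w x + y x) (\<lambda>x. c * word w x + y x)) \<in> ?J)"
    proof (intro impI allI)
      fix \<omega>
      assume s: "(\<lambda>x. c * word w x + y x) \<in> ?T1"
      have len: "length u = 1" if "c * word w u + y u \<noteq> 0" for u
        using s that by (simp add: mem_grade_tensor_algebra)
      have lw: "length w = 1" using len[of w] c y(2) by (simp add: word_def)
      have y1: "y \<in> ?T1"
        unfolding mem_grade_tensor_algebra
      proof (intro conjI allI impI y(1))
        fix u assume "y u \<noteq> 0"
        then show "length u = 1" using len[of u] y(2) by (cases "u = w") (auto simp: word_def)
      qed
      have e1: "word w \<in> ?T1"
        using w lw by (simp add: mem_grade_tensor_algebra) (simp add: word_def)
      \<comment> \<open>\<open>z\<close> collects the reweighted cross terms of \<open>w\<close> with the letters of \<open>y\<close>\<close>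
      define z where "z = reweight (\<lambda>M. \<omega> (mset w + M)) y"
      have z1: "z \<in> ?T1" unfolding z_def by (rule reweight_grade[OF y1])
      let ?e = "word w :: 'v list \<Rightarrow> 'k"
      have "(\<lambda>x. ?e x + z x) \<in> ?T1" by (rule lin_closedD(2)[OF lin_closed_grade e1 z1])
      from sq[OF this]
      have "(\<lambda>x. tensor_mult (\<lambda>x. ?e x + z x) (\<lambda>x. ?e x + z x) x - tensor_mult ?e ?e x) \<in> ?J"
        by (rule J(4)[OF _ sq[OF e1]])
      from J(4)[OF this sq[OF z1]]
      have cross: "(\<lambda>x. tensor_mult ?e z x + tensor_mult z ?e x) \<in> ?J"
        by (simp add: tensor_mult_add_left tensor_mult_add_right algebra_simps)
      have diag: "(\<lambda>x. c * c * \<omega> (mset w + mset w) * tensor_mult ?e ?e x) \<in> ?J"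
        by (rule J(3)[OF sq[OF e1]])
      have yy: "reweight \<omega> (tensor_mult y y) \<in> ?J" using IH y1 by blast
      have "reweight \<omega> (tensor_mult (\<lambda>x. c * ?e x + y x) (\<lambda>x. c * ?e x + y x)) =
          (\<lambda>x. (c * c * \<omega> (mset w + mset w) * tensor_mult ?e ?e x +
             c * (tensor_mult ?e z x + tensor_mult z ?e x)) + reweight \<omega> (tensor_mult y y) x)"
        unfolding tensor_mult_add_left tensor_mult_add_right tensor_mult_scale_left
          tensor_mult_scale_right reweight_add reweight_scale reweight_word_mult
          reweight_mult_word reweight_word z_def
        by (simp add: algebra_simps add.commute)
      also have "\<dots> \<in> ?J"
        by (rule J(2)[OF J(2)[OF diag J(3)[OF cross]] yy])
      finally show "reweight \<omega>
        (tensor_mult (\<lambda>x. c * word w x + y x) (\<lambda>x. c * word w x + y x)) \<in> ?J" .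
    qed
  qed
  then show ?thesis using assms by blast
qed

text \<open>Multihomogeneity of \<open>J\<close>: the elements all of whose reweightings lie in \<open>J\<close> form an ideal
  containing the generators of \<open>J\<close>. Closure under multiplication by a word holds because shifting
  the multidegree turns one reweighting into another.\<close>

lemma SR_kernel_reweight:
  fixes V :: "'v set" and f :: "'v list \<Rightarrow> 'k::field"
  assumes "f \<in> SR_kernel V L"
  shows "reweight \<omega> f \<in> SR_kernel V L"
proof -
  let ?J = "SR_kernel V L :: ('v list \<Rightarrow> 'k) set"
  let ?T = "carrier (tensor_algebra V) :: ('v list \<Rightarrow> 'k) set"
  define K where "K = {f \<in> ?T. \<forall>\<omega>. reweight \<omega> f \<in> ?J}"
  have lc: "lin_closed ?J" and mul: "\<And>f g. f \<in> ?J \<Longrightarrow> g \<in> ?T \<Longrightarrow> tensor_mult f g \<in> ?J \<and> tensor_mult g f \<in> ?J"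
    using tensor_ideal_SR_kernel[of V L] by (auto simp: tensor_ideal_def)
  note J = lin_closedD[OF lc] and T = lin_closedD[OF lin_closed_tensor_algebra[where V = V and ?'k = 'k]]
  have lcK: "lin_closed K"
    unfolding lin_closed_def K_def using J T by (simp add: reweight_add reweight_scale)
  note KC = lin_closedD[OF lcK]
  have "tensor_mult g f \<in> K \<and> tensor_mult f g \<in> K" if f: "f \<in> K" and g: "g \<in> ?T" for f g
    using g
  proof (rule tensor_algebra_induct)
    show "tensor_mult (\<lambda>_. 0) f \<in> K \<and> tensor_mult f (\<lambda>_. 0) \<in> K" using KC(1) by simp
  next
    fix c w and g :: "'v list \<Rightarrow> 'k"
    assume w: "w \<in> lists V" and IH: "tensor_mult g f \<in> K \<and> tensor_mult f g \<in> K"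
    have "tensor_mult (word w) f \<in> K" "tensor_mult f (word w) \<in> K"
      using f w mul unfolding K_def by (simp_all add: reweight_word_mult reweight_mult_word)
    then show "tensor_mult (\<lambda>x. c * word w x + g x) f \<in> K \<and>
        tensor_mult f (\<lambda>x. c * word w x + g x) \<in> K"
      using IH KC(2,3)
      by (simp add: tensor_mult_add_left tensor_mult_add_right tensor_mult_scale_left
          tensor_mult_scale_right)
  qed
  then have "tensor_ideal V K" using lcK by (auto simp: tensor_ideal_def K_def)
  then have "?J \<subseteq> K"
  proof (rule SR_kernel_minimal)
    show "tensor_mult x x \<in> K" if "x \<in> grade (tensor_algebra V) 1" for x
      using reweight_square_in_SR_kernel[OF that] that
      by (simp add: K_def mem_grade_tensor_algebra)
    show "word w \<in> K" if "w \<in> lists V" "set w \<notin> L" for w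
      using that by (auto simp: K_def reweight_word intro!: J(3) nonface_in_SR_kernel)
  qed
  then show ?thesis using assms by (auto simp: K_def)
qed

section \<open>Betti numbers as dimensions of annihilators\<close>

definition annihilator ::
    "'v set \<Rightarrow> ('v list \<Rightarrow> 'k::field) set \<Rightarrow> ('v list \<Rightarrow> 'k) \<Rightarrow> nat \<Rightarrow> ('v list \<Rightarrow> 'k) set" where
  "annihilator V J \<zeta> n = {f \<in> grade (tensor_algebra V) n. tensor_mult f \<zeta> \<in> J}"

lemma lin_closed_annihilator:
  assumes "tensor_ideal V J"
  shows "lin_closed (annihilator V J \<zeta> n)"
proof -
  have "lin_closed J" using assms by (simp add: tensor_ideal_def)
  note J = lin_closedD[OF this] and G = lin_closedD[OF lin_closed_grade[of V n]]
  show ?thesis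
    unfolding lin_closed_def annihilator_def
    using J G by (auto simp: tensor_mult_add_left tensor_mult_scale_left intro: G)
qed

text \<open>Let \<open>T\<^sub>n\<close> be the span of the words of length \<open>n\<close>, let \<open>Z\<^sub>n\<close> be the annihilator of \<open>\<zeta>\<close> modulo
  \<open>J\<close> in \<open>T\<^sub>n\<close>, and let \<open>N\<close> be the space of coboundaries in \<open>A\<close>. The preimage \<open>Q\<close> of \<open>N\<close> in \<open>Z\<^sub>n\<^sub>+\<^sub>1\<close>
  has dimension \<open>dim N + dim (J \<inter> T\<^sub>n\<^sub>+\<^sub>1)\<close>, and \<open>dim N = dim T\<^sub>n - dim Z\<^sub>n\<close>, so the Betti
  number \<open>dim Z\<^sub>n\<^sub>+\<^sub>1 - dim Q\<close> depends on \<open>\<zeta>\<close> only through \<open>dim Z\<^sub>n\<close> and \<open>dim Z\<^sub>n\<^sub>+\<^sub>1\<close>, on both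
  increasingly, and on \<open>A\<close> only through the kernel \<open>J\<close>.\<close>

lemma betti_add_fdim:
  fixes A :: "('k::field, 'a, 'm) graded_algebra_scheme" and \<Phi> :: "('v list \<Rightarrow> 'k) \<Rightarrow> 'a"
  assumes "finite V" and onto: "algebra_onto V A \<Phi>"
    and J: "{f \<in> carrier (tensor_algebra V). \<Phi> f = \<zero>\<^bsub>A\<^esub>} = J"
    and \<zeta>: "\<zeta> \<in> grade (tensor_algebra V) 1" and sq: "tensor_mult \<zeta> \<zeta> \<in> J"
  shows "betti A (\<Phi> \<zeta>) (Suc n) + fdim (grade (tensor_algebra V) n :: ('v list \<Rightarrow> 'k) set)
      + fdim (J \<inter> grade (tensor_algebra V) (Suc n))
    = fdim (annihilator V J \<zeta> (Suc n)) + fdim (annihilator V J \<zeta> n)"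
proof -
  let ?T = "grade (tensor_algebra V) :: nat \<Rightarrow> ('v list \<Rightarrow> 'k) set"
  let ?Z = "annihilator V J \<zeta>"
  note D = linear_ontoD[OF algebra_ontoD(1)[OF onto]] and M = algebra_ontoD(3,4)[OF onto]
  have id: "tensor_ideal V J" using algebra_onto_kernel[OF onto] J by simp
  have TT: "f \<in> carrier (tensor_algebra V)" if "f \<in> ?T m" for f m
    using that by (simp add: mem_grade_tensor_algebra)
  have \<zeta>c: "\<zeta> \<in> carrier (tensor_algebra V)" by (rule TT[OF \<zeta>])
  have inJ: "f \<in> J \<longleftrightarrow> \<Phi> f = \<zero>\<^bsub>A\<^esub>" if "f \<in> carrier (tensor_algebra V)" for f
    using that by (auto simp: J[symmetric])
  have ZT: "?Z m \<subseteq> ?T m" for m by (auto simp: annihilator_def)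
  have ZC: "?Z m \<subseteq> carrier (tensor_algebra V)" for m using ZT TT by blast
  have fsZ: "fin_supp_space (?Z m)" for m
    by (rule fin_supp_space_mono[OF fin_supp_space_grade[OF \<open>finite V\<close>]
          lin_closed_annihilator[OF id] ZT])
  define B where "B = (\<lambda>g. tensor_mult g \<zeta>) ` ?T n"
  have lcB: "lin_closed B"
    unfolding lin_closed_def
  proof (intro conjI ballI allI)
    show "(\<lambda>_. 0) \<in> B"
      unfolding B_def using lin_closedD(1)[OF lin_closed_grade[of V n]]
      by (intro image_eqI[of _ _ "\<lambda>_. 0"]) simp_all
  next
    fix f g assume "f \<in> B" "g \<in> B"
    then obtain f' g' where "f' \<in> ?T n" "g' \<in> ?T n" "f = tensor_mult f' \<zeta>" "g = tensor_mult g' \<zeta>"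
      by (auto simp: B_def)
    then show "(\<lambda>x. f x + g x) \<in> B"
      unfolding B_def using lin_closedD(2)[OF lin_closed_grade, of f' V n g']
      by (intro image_eqI[of _ _ "\<lambda>x. f' x + g' x"]) (simp_all add: tensor_mult_add_left)
  next
    fix c f assume "f \<in> B"
    then obtain f' where "f' \<in> ?T n" "f = tensor_mult f' \<zeta>" by (auto simp: B_def)
    then show "(\<lambda>x. c * f x) \<in> B"
      unfolding B_def using lin_closedD(3)[OF lin_closed_grade, of f' V n c]
      by (intro image_eqI[of _ _ "\<lambda>x. c * f' x"]) (simp_all add: tensor_mult_scale_left)
  qed
  have BZ: "B \<subseteq> ?Z (Suc n)"
  proof
    fix f assume "f \<in> B"
    then obtain g where g: "g \<in> ?T n" "f = tensor_mult g \<zeta>" by (auto simp: B_def)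
    have "f \<in> ?T (Suc n)" using tensor_mult_grade[OF g(1) \<zeta>] g(2) by simp
    moreover have "tensor_mult f \<zeta> \<in> J"
      using id sq TT[OF g(1)] g(2) by (simp add: tensor_mult_assoc tensor_ideal_def)
    ultimately show "f \<in> ?Z (Suc n)" by (simp add: annihilator_def)
  qed
  have cocyc: "mult_cocycles A (\<Phi> \<zeta>) (Suc n) = \<Phi> ` ?Z (Suc n)"
    unfolding mult_cocycles_def annihilator_def M(2)[symmetric]
    using TT \<zeta>c by (auto simp: M(1)[symmetric] inJ)
  have cobound: "mult_coboundaries A (\<Phi> \<zeta>) (Suc n) = \<Phi> ` B"
    unfolding mult_coboundaries_def M(2)[symmetric] B_def
    using TT \<zeta>c by (auto simp: M(1) image_image)
  let ?M = "A\<lparr>carrier := \<Phi> ` ?Z (Suc n)\<rparr>" and ?N = "A\<lparr>carrier := \<Phi> ` B\<rparr>"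
  let ?H = "quot_space ?M (\<Phi> ` B)"
  have ontoZ: "linear_onto (?Z (Suc n)) ?M \<Phi>"
    by (rule linear_onto_restrict[OF algebra_ontoD(1)[OF onto] lin_closed_annihilator[OF id] ZC])
  note subN = submodule_image[OF ontoZ lcB BZ]
  define Q where "Q = {f \<in> ?Z (Suc n). \<Phi> f \<in> \<Phi> ` B}"
  have "{f \<in> ?Z (Suc n). \<Phi> ` B +>\<^bsub>?M\<^esub> \<Phi> f = \<zero>\<^bsub>?H\<^esub>} = Q"
    unfolding Q_def using linear_onto_quotient(2)[OF ontoZ subN] by auto
  with linear_onto_rank_nullity[OF linear_onto_quotient(1)[OF ontoZ subN] fsZ]
  have 1: "vectorspace.dim class_ring ?H + fdim Q = fdim (?Z (Suc n))" by simp
  have lcQ: "lin_closed Q"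
    using linear_onto_kernel_lin_closed[OF linear_onto_quotient(1)[OF ontoZ subN]]
      \<open>{f \<in> ?Z (Suc n). \<Phi> ` B +>\<^bsub>?M\<^esub> \<Phi> f = \<zero>\<^bsub>?H\<^esub>} = Q\<close> by simp
  have QZ: "Q \<subseteq> ?Z (Suc n)" by (auto simp: Q_def)
  have "\<Phi> ` Q = \<Phi> ` B" using BZ by (auto simp: Q_def)
  then have ontoQ: "linear_onto Q ?N \<Phi>"
    using linear_onto_restrict[OF algebra_ontoD(1)[OF onto] lcQ] QZ ZC by auto
  have "{f \<in> Q. \<Phi> f = \<zero>\<^bsub>?N\<^esub>} = J \<inter> ?T (Suc n)"
  proof (intro equalityI subsetI)
    fix f assume f: "f \<in> {f \<in> Q. \<Phi> f = \<zero>\<^bsub>?N\<^esub>}"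
    then have "f \<in> ?T (Suc n)" using QZ ZT by blast
    then show "f \<in> J \<inter> ?T (Suc n)" using f inJ[OF TT] by simp
  next
    fix f assume f: "f \<in> J \<inter> ?T (Suc n)"
    then have "\<Phi> f = \<Phi> (\<lambda>_. 0)" using D(3) TT by (auto simp: inJ)
    then have "\<Phi> f \<in> \<Phi> ` B" using lin_closedD(1)[OF lcB] by auto
    moreover have "f \<in> ?Z (Suc n)" using f id \<zeta>c by (auto simp: annihilator_def tensor_ideal_def)
    ultimately show "f \<in> {f \<in> Q. \<Phi> f = \<zero>\<^bsub>?N\<^esub>}" using f TT by (auto simp: Q_def inJ)
  qed
  with linear_onto_rank_nullity[OF ontoQ fin_supp_space_mono[OF fsZ lcQ QZ]]
  have 2: "vectorspace.dim class_ring ?N + fdim (J \<inter> ?T (Suc n)) = fdim Q" by simp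
  have ontoT: "linear_onto (?T n) ?N (\<lambda>g. \<Phi> (tensor_mult g \<zeta>))"
    unfolding linear_onto_def
  proof (intro conjI ballI allI)
    fix f g assume fg: "f \<in> ?T n" "g \<in> ?T n"
    show "\<Phi> (tensor_mult (\<lambda>x. f x + g x) \<zeta>) = \<Phi> (tensor_mult f \<zeta>) \<oplus>\<^bsub>?N\<^esub> \<Phi> (tensor_mult g \<zeta>)"
      using D(4)[OF tensor_mult_closed tensor_mult_closed, OF TT[OF fg(1)] \<zeta>c TT[OF fg(2)] \<zeta>c]
      by (simp add: tensor_mult_add_left)
  next
    fix c f assume f: "f \<in> ?T n"
    show "\<Phi> (tensor_mult (\<lambda>x. c * f x) \<zeta>) = c \<odot>\<^bsub>?N\<^esub> \<Phi> (tensor_mult f \<zeta>)"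
      using D(5)[OF tensor_mult_closed, OF TT[OF f] \<zeta>c]
      by (simp add: tensor_mult_scale_left)
  qed (use D(3) in \<open>simp_all add: lin_closed_grade B_def image_image\<close>)
  have "{g \<in> ?T n. \<Phi> (tensor_mult g \<zeta>) = \<zero>\<^bsub>?N\<^esub>} = ?Z n"
    unfolding annihilator_def using TT \<zeta>c by (auto simp: inJ)
  with linear_onto_rank_nullity[OF ontoT fin_supp_space_grade[OF \<open>finite V\<close>]]
  have 3: "vectorspace.dim class_ring ?N + fdim (?Z n) = fdim (?T n)" by simp
  show ?thesis
    using 1 2 3 by (simp add: betti_def mult_cohomology_def cocyc cobound)
qed

section \<open>Shrinking the support of a linear form\<close>

lemma tensor_mult_grade_one:
  assumes "\<zeta> \<in> grade (tensor_algebra V) 1"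
  shows "tensor_mult f \<zeta> (u @ [v]) = f u * \<zeta> [v]" "tensor_mult f \<zeta> [] = 0"
proof -
  have 0: "\<zeta> w = 0" if "length w \<noteq> 1" for w
    using assms that by (auto simp: mem_grade_tensor_algebra)
  show "tensor_mult f \<zeta> [] = 0" using 0[of "[]"] by (simp add: tensor_mult_def)
  have "tensor_mult f \<zeta> (u @ [v]) = (\<Sum>j\<le>Suc (length u). if j = length u then f u * \<zeta> [v] else 0)"
    unfolding tensor_mult_def using 0 by (intro sum.cong) auto
  then show "tensor_mult f \<zeta> (u @ [v]) = f u * \<zeta> [v]" by simp
qed

text \<open>Degeneration of \<open>\<zeta>\<close> to \<open>\<xi>\<close>: let \<open>W\<close> be the support of \<open>\<xi>\<close>, and filter words by the number of
  letters outside \<open>W\<close>. Multiplication by the part of \<open>\<zeta>\<close> inside \<open>W\<close> preserves this number and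
  multiplication by the rest raises it, so the lowest component of an element killed by \<open>\<zeta>\<close> is
  killed by the part of \<open>\<zeta>\<close> inside \<open>W\<close>. The torus element \<open>q\<close> carries that part to \<open>\<xi>\<close>. Since both
  steps are a single reweighting, multihomogeneity of \<open>J\<close> applies. The argument is valid over
  every field, in particular over finite ones, where there is no generic point to specialise.\<close>

lemma fdim_annihilator_le:
  fixes V :: "'v set" and \<zeta> \<xi> :: "'v list \<Rightarrow> 'k::field"
  assumes "finite V" and \<zeta>: "\<zeta> \<in> grade (tensor_algebra V) 1"
    and \<xi>: "\<xi> \<in> grade (tensor_algebra V) 1" and supp: "\<And>v. \<xi> [v] \<noteq> 0 \<Longrightarrow> \<zeta> [v] \<noteq> 0"
  shows "fdim (annihilator V (SR_kernel V L) \<zeta> n) \<le> fdim (annihilator V (SR_kernel V L) \<xi> n)"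
proof -
  let ?J = "SR_kernel V L :: ('v list \<Rightarrow> 'k) set"
  define q where "q v = (if \<xi> [v] = 0 then 1 else \<xi> [v] / \<zeta> [v])" for v
  define c where "c w = prod_mset (image_mset q (mset w))" for w
  define r where "r w = size (filter_mset (\<lambda>v. \<xi> [v] = 0) (mset w))" for w
  have q: "q v \<noteq> 0" for v using supp by (auto simp: q_def)
  have fs: "fin_supp_space (annihilator V ?J \<theta> n)" for \<theta>
    by (rule fin_supp_space_mono[OF fin_supp_space_grade[OF \<open>finite V\<close>]
          lin_closed_annihilator[OF tensor_ideal_SR_kernel]]) (auto simp: annihilator_def)
  show ?thesis
  proof (rule fdim_filtration_le[OF fs fs, where c = c and r = r])
    show "c w \<noteq> 0" for w by (induction w) (simp_all add: c_def q)
  next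
    fix p and f :: "'v list \<Rightarrow> 'k"
    assume f: "f \<in> annihilator V ?J \<zeta> n" and low: "\<And>w. f w \<noteq> 0 \<Longrightarrow> p \<le> r w"
    let ?\<omega> = "\<lambda>M. if size (filter_mset (\<lambda>v. \<xi> [v] = 0) M) = p
      then prod_mset (image_mset q M) else 0"
    let ?g = "\<lambda>w. if r w = p then c w * f w else 0"
    have g: "?g = reweight ?\<omega> f" by (auto simp: reweight_def r_def c_def fun_eq_iff)
    have "tensor_mult ?g \<xi> = reweight ?\<omega> (tensor_mult f \<zeta>)"
    proof
      fix w
      show "tensor_mult ?g \<xi> w = reweight ?\<omega> (tensor_mult f \<zeta>) w"
      proof (cases w rule: rev_cases)
        case Nil
        then show ?thesis
          using tensor_mult_grade_one(2)[OF \<zeta>] tensor_mult_grade_one(2)[OF \<xi>]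
          by (simp add: reweight_def)
      next
        case (snoc u v)
        have "tensor_mult ?g \<xi> w = ?g u * \<xi> [v]"
          unfolding snoc by (rule tensor_mult_grade_one(1)[OF \<xi>])
        also have "\<dots> = ?\<omega> (mset w) * (f u * \<zeta> [v])"
        proof (cases "\<xi> [v] = 0")
          case True
          \<comment> \<open>appending \<open>v\<close> raises the rank, so only words of rank \<open>p - 1\<close>, where \<open>f\<close> vanishes, could
            contribute\<close>
          have "f u = 0" if "Suc (r u) = p" using low[of u] that by auto
          then show ?thesis using True by (auto simp: snoc r_def)
        next
          case False
          then show ?thesis using supp[of v] by (simp add: snoc r_def c_def q_def)
        qed
        also have "\<dots> = reweight ?\<omega> (tensor_mult f \<zeta>) w"
          unfolding reweight_def snoc tensor_mult_grade_one(1)[OF \<zeta>] ..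
        finally show ?thesis .
      qed
    qed
    then show "?g \<in> annihilator V ?J \<xi> n"
      using f SR_kernel_reweight[of "tensor_mult f \<zeta>" V L ?\<omega>]
      unfolding annihilator_def g by (simp add: reweight_grade)
  qed
qed

section \<open>Linear forms in the Stanley--Reisner ring\<close>

definition linear_forms :: "'v set \<Rightarrow> 'v set \<Rightarrow> ('v list \<Rightarrow> 'k::field) set" where
  "linear_forms V W = {\<zeta> \<in> grade (tensor_algebra V) 1. \<forall>v. \<zeta> [v] \<noteq> 0 \<longrightarrow> v \<in> W}"

definition coord_sum :: "'v set \<Rightarrow> 'v list \<Rightarrow> 'k::field" where
  "coord_sum W = (\<lambda>x. \<Sum>v\<in>W. word [v] x)"

lemma lin_closed_linear_forms:
  fixes V W :: "'v set"
  shows "lin_closed (linear_forms V W :: ('v list \<Rightarrow> 'k::field) set)"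
  using lin_closedD[OF lin_closed_grade[where V = V and n = 1 and ?'k = 'k]]
  unfolding lin_closed_def linear_forms_def by (auto, metis add_0)

lemma linear_form_expansion:
  assumes "finite W" "\<zeta> \<in> linear_forms V W"
  shows "\<zeta> = (\<lambda>x. \<Sum>v\<in>W. \<zeta> [v] * word [v] x)"
proof
  fix x
  show "\<zeta> x = (\<Sum>v\<in>W. \<zeta> [v] * word [v] x)"
  proof (cases "length x = 1")
    case True
    then obtain u where x: "x = [u]" by (cases x) auto
    have "(\<Sum>v\<in>W. \<zeta> [v] * word [v] x) = (\<Sum>v\<in>W. if v = u then \<zeta> [u] else 0)"
      by (intro sum.cong) (auto simp: x word_def)
    then show ?thesis using assms by (auto simp: x linear_forms_def)
  next
    case False
    then have "\<zeta> x = 0" using assms(2) by (auto simp: linear_forms_def mem_grade_tensor_algebra)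
    moreover have "word [v] x = (0 :: 'b)" for v using False by (auto simp: word_def)
    ultimately show ?thesis by simp
  qed
qed

lemma word_grade_one: "v \<in> V \<Longrightarrow> word [v] \<in> grade (tensor_algebra V) 1"
  unfolding mem_grade_tensor_algebra by (auto simp: word_def[of "[v]"])

lemma coord_sum_grade_one:
  fixes V W :: "'v set"
  assumes "finite W" "W \<subseteq> V"
  shows "(coord_sum W :: 'v list \<Rightarrow> 'k::field) \<in> grade (tensor_algebra V) 1"
  using assms
proof (induction W rule: finite_induct)
  case empty
  then show ?case using lin_closedD(1)[OF lin_closed_grade] by (simp add: coord_sum_def)
next
  case (insert v W)
  then show ?case
    using lin_closedD(2)[OF lin_closed_grade word_grade_one[of v V] insert.IH]
    by (simp add: coord_sum_def)
qed

lemma coord_sum_eval: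
  "finite W \<Longrightarrow> coord_sum W [v] = (if v \<in> W then 1 else (0 :: 'k::field))"
proof -
  assume W: "finite W"
  have "coord_sum W [v] = (\<Sum>u\<in>W. if u = v then 1 else (0 :: 'k))"
    unfolding coord_sum_def by (intro sum.cong) (auto simp: word_def)
  then show ?thesis using W by simp
qed

lemma SR_gen_map: "SR_gen V L v = SR_map V L (word [v])"
  by (simp add: SR_gen_def SR_map_def exterior_monomial_word)

lemma SR_sum_map:
  fixes V W :: "'v set"
  assumes "finite W" "W \<subseteq> V"
  shows "(SR_sum V L W :: ('v list \<Rightarrow> 'k::field) set set) = SR_map V L (coord_sum W)"
proof -
  note D = linear_ontoD[OF algebra_ontoD(1)[OF SR_algebra_onto[where V = V and L = L and ?'k = 'k]]]
  interpret SR: ring "SR_algebra V L :: ('k, _) graded_algebra"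
    by (rule algebra_onto_ring[OF SR_algebra_onto])
  have T: "f \<in> carrier (tensor_algebra V)" if "f \<in> grade (tensor_algebra V) 1" for f :: "'v list \<Rightarrow> 'k"
    using that by (simp add: mem_grade_tensor_algebra)
  show ?thesis
    using assms unfolding SR_sum_def
  proof (induction W rule: finite_induct)
    case empty
    then show ?case using D(3) by (simp add: coord_sum_def)
  next
    case (insert v W)
    have gen: "(SR_gen V L u :: ('v list \<Rightarrow> 'k) set set) \<in> carrier (SR_algebra V L)" if "u \<in> V" for u
      unfolding SR_gen_map using D(6) that by simp
    have "finsum (SR_algebra V L) (SR_gen V L) (insert v W) =
        SR_gen V L v \<oplus>\<^bsub>SR_algebra V L\<^esub>
          (finsum (SR_algebra V L) (SR_gen V L) W :: ('v list \<Rightarrow> 'k) set set)"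
      by (rule SR.finsum_insert) (use insert gen in auto)
    also have "\<dots> = SR_map V L (word [v]) \<oplus>\<^bsub>SR_algebra V L\<^esub> SR_map V L (coord_sum W)"
      using insert.IH insert.prems by (simp only: SR_gen_map[symmetric] insert_subset)
    also have "\<dots> = SR_map V L (\<lambda>x. word [v] x + coord_sum W x)"
      using insert by (intro D(4)[symmetric] T word_grade_one coord_sum_grade_one) auto
    finally show ?case using insert by (simp add: coord_sum_def)
  qed
qed

lemma coord_subspace_map:
  fixes V W :: "'v set"
  assumes "finite W" "W \<subseteq> V"
  shows "(coord_subspace V L W :: ('v list \<Rightarrow> 'k::field) set set set)
    = SR_map V L ` linear_forms V W"
proof -
  let ?A = "SR_algebra V L :: ('k, _) graded_algebra"
  let ?\<Phi> = "SR_map V L :: ('v list \<Rightarrow> 'k) \<Rightarrow> _"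
  note onto = algebra_ontoD(1)[OF SR_algebra_onto[where V = V and L = L and ?'k = 'k]]
  note D = linear_ontoD[OF onto]
  have T: "f \<in> carrier (tensor_algebra V)" if "f \<in> grade (tensor_algebra V) 1" for f :: "'v list \<Rightarrow> 'k"
    using that by (simp add: mem_grade_tensor_algebra)
  interpret module class_ring ?A by (rule linear_onto_module[OF onto])
  have gens: "SR_gen V L ` W \<subseteq> ?\<Phi> ` linear_forms V W"
    using assms(2) word_grade_one[of _ V]
    by (auto simp: SR_gen_map linear_forms_def word_def[abs_def] intro!: imageI split: if_splits)
  have sub: "submodule class_ring (?\<Phi> ` linear_forms V W) ?A"
    using T by (intro submodule_image[OF onto lin_closed_linear_forms]) (auto simp: linear_forms_def)
  have genc: "SR_gen V L ` W \<subseteq> carrier ?A"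
    using gens submodule.subset[OF sub] by blast
  have spn: "submodule class_ring (span (SR_gen V L ` W)) ?A"
    by (rule span_is_submodule[OF genc])
  have own: "SR_gen V L ` W \<subseteq> span (SR_gen V L ` W)" by (rule in_own_span[OF genc])
  have comb: "(\<lambda>x. \<Sum>v\<in>Y. c v * word [v] x) \<in> grade (tensor_algebra V) 1 \<and>
      ?\<Phi> (\<lambda>x. \<Sum>v\<in>Y. c v * word [v] x) \<in> span (SR_gen V L ` W)" if "Y \<subseteq> W" for Y and c :: "'v \<Rightarrow> 'k"
    using finite_subset[OF that assms(1)] that
  proof (induction Y rule: finite_induct)
    case empty
    then show ?case
      using D(3) submodule.zero_closed[OF spn] lin_closedD(1)[OF lin_closed_grade] by simp
  next
    case (insert v Y)
    have v: "v \<in> W" "v \<in> V" using insert.prems assms(2) by auto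
    let ?s = "\<lambda>x. \<Sum>v\<in>Y. c v * word [v] x"
    have w: "(\<lambda>x. c v * word [v] x) \<in> grade (tensor_algebra V) 1"
      by (rule lin_closedD(3)[OF lin_closed_grade word_grade_one[OF v(2)]])
    have s: "?s \<in> grade (tensor_algebra V) 1" "?\<Phi> ?s \<in> span (SR_gen V L ` W)"
      using insert.IH insert.prems by auto
    have "?\<Phi> (\<lambda>x. c v * word [v] x) = c v \<odot>\<^bsub>?A\<^esub> SR_gen V L v"
      unfolding SR_gen_map by (rule D(5)[OF T[OF word_grade_one[OF v(2)]]])
    also have "\<dots> \<in> span (SR_gen V L ` W)"
      using own v(1) by (intro submodule.smult_closed[OF spn]) auto
    finally have "?\<Phi> (\<lambda>x. c v * word [v] x + ?s x) \<in> span (SR_gen V L ` W)"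
      using D(4)[OF T[OF w] T[OF s(1)]] s(2) submodule.m_closed[OF spn] by simp
    then show ?case
      using insert.hyps lin_closedD(2)[OF lin_closed_grade w s(1)] by simp
  qed
  have "?\<Phi> ` linear_forms V W \<subseteq> span (SR_gen V L ` W)"
  proof
    fix z assume "z \<in> ?\<Phi> ` linear_forms V W"
    then obtain \<zeta> where \<zeta>: "\<zeta> \<in> linear_forms V W" "z = ?\<Phi> \<zeta>" by blast
    show "z \<in> span (SR_gen V L ` W)"
      unfolding \<zeta>(2) using comb[of W "\<lambda>v. \<zeta> [v]"] linear_form_expansion[OF assms(1) \<zeta>(1)] by simp
  qed
  then show ?thesis unfolding coord_subspace_def using span_is_subset[OF gens sub] by blast
qed

lemma betti_eq_of_kernel:
  fixes A :: "('k::field, 'a, 'm) graded_algebra_scheme" and B :: "('k, 'b, 'n) graded_algebra_scheme"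
    and \<Phi> :: "('v list \<Rightarrow> 'k) \<Rightarrow> 'a"
  assumes "finite V" "algebra_onto V A \<Phi>" "algebra_onto V B \<Psi>"
    and "{f \<in> carrier (tensor_algebra V). \<Phi> f = \<zero>\<^bsub>A\<^esub>} = SR_kernel V L"
    and "{f \<in> carrier (tensor_algebra V). \<Psi> f = \<zero>\<^bsub>B\<^esub>} = SR_kernel V L"
    and \<zeta>: "\<zeta> \<in> grade (tensor_algebra V) 1" and "i \<ge> 1"
  shows "betti A (\<Phi> \<zeta>) i = betti B (\<Psi> \<zeta>) i"
  using betti_add_fdim[OF assms(1,2,4) \<zeta> square_in_SR_kernel[OF \<zeta>], of "i - 1"]
    betti_add_fdim[OF assms(1,3,5) \<zeta> square_in_SR_kernel[OF \<zeta>], of "i - 1"] assms(7)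
  by simp

section \<open>Resonance varieties\<close>

lemma betti_support_antimono:
  fixes V :: "'v set" and \<zeta> \<xi> :: "'v list \<Rightarrow> 'k::field"
  assumes V: "finite V" and \<zeta>: "\<zeta> \<in> grade (tensor_algebra V) 1"
    and \<xi>: "\<xi> \<in> grade (tensor_algebra V) 1"
    and supp: "\<And>v. \<xi> [v] \<noteq> 0 \<Longrightarrow> \<zeta> [v] \<noteq> 0" and "i \<ge> 1"
  shows "betti (SR_algebra V L :: ('k, _) graded_algebra) (SR_map V L \<zeta>) i
    \<le> betti (SR_algebra V L :: ('k, _) graded_algebra) (SR_map V L \<xi>) i"
proof -
  note b = betti_add_fdim[OF V SR_algebra_onto SR_kernel_def[symmetric, of V L], of _ "i - 1"]
  show ?thesis
    using b[OF \<zeta> square_in_SR_kernel[OF \<zeta>]] b[OF \<xi> square_in_SR_kernel[OF \<xi>]]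
      fdim_annihilator_le[OF V \<zeta> \<xi> supp, of L i] fdim_annihilator_le[OF V \<zeta> \<xi> supp, of L "i - 1"]
      \<open>i \<ge> 1\<close>
    by simp
qed

lemma resonance_image:
  assumes "algebra_onto V A \<Phi>"
  shows "resonance A i d = \<Phi> ` {\<zeta> \<in> grade (tensor_algebra V) 1. betti A (\<Phi> \<zeta>) i \<ge> d}"
  unfolding resonance_def algebra_ontoD(4)[OF assms, symmetric] by blast

text \<open>A bijection preserving \<open>\<oplus>\<close> maps \<open>\<zero>\<^bsub>A\<^esub>\<close> to the only idempotent of \<open>\<oplus>\<close> in its target, so the
  two hypotheses on \<open>\<zero>\<^bsub>B\<^esub>\<close> identify the image.\<close>

lemma graded_algebra_iso_algebra_onto:
  fixes A :: "('k::field, 'a, 'm) graded_algebra_scheme" and B :: "('k, 'b, 'n) graded_algebra_scheme"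
    and \<Phi> :: "('v list \<Rightarrow> 'k) \<Rightarrow> 'a"
  assumes onto: "algebra_onto V A \<Phi>" and iso: "\<phi> \<in> graded_algebra_iso A B"
    and zB: "\<zero>\<^bsub>B\<^esub> \<in> carrier B" "\<zero>\<^bsub>B\<^esub> \<oplus>\<^bsub>B\<^esub> \<zero>\<^bsub>B\<^esub> = \<zero>\<^bsub>B\<^esub>"
  shows "algebra_onto V B (\<phi> \<circ> \<Phi>)"
    and "f \<in> carrier (tensor_algebra V) \<Longrightarrow> (\<phi> \<circ> \<Phi>) f = \<zero>\<^bsub>B\<^esub> \<longleftrightarrow> \<Phi> f = \<zero>\<^bsub>A\<^esub>"
proof -
  note D = linear_ontoD[OF algebra_ontoD(1)[OF onto]] and M = algebra_ontoD(2,3,4)[OF onto]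
  interpret ring A by (rule algebra_onto_ring[OF onto])
  have hom: "\<phi> \<in> Ring.ring_hom A B" and bij: "bij_betw \<phi> (carrier A) (carrier B)"
    and mh: "\<phi> \<in> module_hom class_ring A B" and gr: "\<And>n. \<phi> ` grade A n = grade B n"
    using iso by (auto simp: graded_algebra_iso_def ring_iso_def)
  obtain x where x: "x \<in> carrier A" "\<phi> x = \<zero>\<^bsub>B\<^esub>"
    using zB(1) bij_betw_imp_surj_on[OF bij] by (metis imageE)
  \<comment> \<open>the preimage of \<open>\<zero>\<^bsub>B\<^esub>\<close> is idempotent for \<open>\<oplus>\<close>, hence zero\<close>
  have "\<phi> (x \<oplus>\<^bsub>A\<^esub> x) = \<phi> x"
    using ring_hom_add[OF hom x(1) x(1)] x(2) zB(2) by simp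
  then have "x \<oplus>\<^bsub>A\<^esub> x = x"
    using bij x(1) by (auto simp: bij_betw_def inj_on_def)
  then have "x = \<zero>\<^bsub>A\<^esub>" using x(1) by (metis add.l_cancel_one)
  then have z: "\<phi> \<zero>\<^bsub>A\<^esub> = \<zero>\<^bsub>B\<^esub>" using x(2) by simp
  show "algebra_onto V B (\<phi> \<circ> \<Phi>)"
    unfolding algebra_onto_def linear_onto_def
  proof (intro conjI ballI allI)
    show "lin_closed (carrier (tensor_algebra V) :: ('v list \<Rightarrow> 'k) set)" by (rule D(1))
    show "(\<phi> \<circ> \<Phi>) ` carrier (tensor_algebra V) = carrier B"
      by (simp only: image_comp[symmetric] D(2) bij_betw_imp_surj_on[OF bij])
    show "(\<phi> \<circ> \<Phi>) (\<lambda>_. 0) = \<zero>\<^bsub>B\<^esub>" using D(3) z by simp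
    show "(\<phi> \<circ> \<Phi>) (word []) = \<one>\<^bsub>B\<^esub>" using M(1) ring_hom_one[OF hom] by simp
    show "(\<phi> \<circ> \<Phi>) ` grade (tensor_algebra V) n = grade B n" for n
      by (simp only: image_comp[symmetric] M(3) gr)
  next
    fix f g :: "'v list \<Rightarrow> 'k" and c
    assume f: "f \<in> carrier (tensor_algebra V)"
    show "(\<phi> \<circ> \<Phi>) (\<lambda>x. c * f x) = c \<odot>\<^bsub>B\<^esub> (\<phi> \<circ> \<Phi>) f"
      using D(5)[OF f] module_hom_smult[OF mh _ D(6)[OF f], of c] by simp
    assume g: "g \<in> carrier (tensor_algebra V)"
    show "(\<phi> \<circ> \<Phi>) (\<lambda>x. f x + g x) = (\<phi> \<circ> \<Phi>) f \<oplus>\<^bsub>B\<^esub> (\<phi> \<circ> \<Phi>) g"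
      using D(4)[OF f g] ring_hom_add[OF hom D(6)[OF f] D(6)[OF g]] by simp
    show "(\<phi> \<circ> \<Phi>) (tensor_mult f g) = (\<phi> \<circ> \<Phi>) f \<otimes>\<^bsub>B\<^esub> (\<phi> \<circ> \<Phi>) g"
      using M(2)[OF f g] ring_hom_mult[OF hom D(6)[OF f] D(6)[OF g]] by simp
  qed
  show "(\<phi> \<circ> \<Phi>) f = \<zero>\<^bsub>B\<^esub> \<longleftrightarrow> \<Phi> f = \<zero>\<^bsub>A\<^esub>" if "f \<in> carrier (tensor_algebra V)"
    using inj_on_eq_iff[OF bij_betw_imp_inj_on[OF bij] D(6)[OF that] zero_closed] z by simp
qed

text \<open>The zero coset is the set of coboundaries. It is the coset of the zero cocycle and is closed
  under addition, which is what an isomorphism onto the cohomology algebra needs in order to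
  preserve zero.\<close>

lemma cohomology_algebra_zero:
  fixes X :: "'a topology"
  defines "H \<equiv> cohomology_algebra X :: ('k::field, _) graded_algebra"
  shows "\<zero>\<^bsub>H\<^esub> \<in> carrier H" "\<zero>\<^bsub>H\<^esub> \<oplus>\<^bsub>H\<^esub> \<zero>\<^bsub>H\<^esub> = \<zero>\<^bsub>H\<^esub>"
proof -
  let ?S = "singular_cochains X :: ('k, _) graded_algebra"
  let ?A = "?S\<lparr>carrier := singular_cocycles X,
    grade := \<lambda>n. singular_cocycles X \<inter> grade ?S n\<rparr>"
  let ?B = "coboundary X ` carrier ?S"
  let ?o = "(\<lambda>n f. 0) :: nat \<Rightarrow> ((nat \<Rightarrow> real) \<Rightarrow> 'a) \<Rightarrow> 'k"
  have add: "a \<oplus>\<^bsub>?S\<^esub> b = (\<lambda>n f. a n f + b n f)" and zero: "\<zero>\<^bsub>?S\<^esub> = ?o" for a b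
    by (simp_all add: singular_cochains_def Let_def)
  have mem: "c \<in> carrier ?S \<longleftrightarrow>
      (\<forall>n f. \<not> singular_simplex n X f \<longrightarrow> c n f = 0) \<and> finite {n. \<exists>f. c n f \<noteq> 0}" for c
    by (simp add: singular_cochains_def Let_def)
  have o: "?o \<in> carrier ?S" by (simp add: mem)
  have co: "coboundary X ?o = ?o" by (simp add: coboundary_def fun_eq_iff)
  have sum: "(\<lambda>n f. a n f + b n f) \<in> carrier ?S" if "a \<in> carrier ?S" "b \<in> carrier ?S" for a b
  proof -
    have "{n. \<exists>f. a n f + b n f \<noteq> 0} \<subseteq> {n. \<exists>f. a n f \<noteq> 0} \<union> {n. \<exists>f. b n f \<noteq> 0}"
      by force
    from finite_subset[OF this] show ?thesis using that by (auto simp: mem)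
  qed
  have csum: "coboundary X (\<lambda>n f. a n f + b n f) = (\<lambda>n f. coboundary X a n f + coboundary X b n f)"
    for a b :: "nat \<Rightarrow> ((nat \<Rightarrow> real) \<Rightarrow> 'a) \<Rightarrow> 'k"
    by (simp add: coboundary_def fun_eq_iff distrib_left sum.distrib)
  have B0: "?o \<in> ?B" using o co by (metis imageI)
  have "?o \<in> singular_cocycles X" using o co by (simp add: singular_cocycles_def zero)
  moreover have "?B +>\<^bsub>?A\<^esub> ?o = ?B" by (auto simp: a_r_coset_def' add)
  ultimately show "\<zero>\<^bsub>H\<^esub> \<in> carrier H"
    unfolding H_def cohomology_algebra_def by (auto simp: A_RCOSETS_def')
  have "?B <+>\<^bsub>?A\<^esub> ?B = ?B"
  proof (intro equalityI subsetI)
    fix c assume "c \<in> ?B <+>\<^bsub>?A\<^esub> ?B"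
    then obtain a b where "a \<in> carrier ?S" "b \<in> carrier ?S"
        "c = (\<lambda>n f. coboundary X a n f + coboundary X b n f)"
      by (auto simp: set_add_def' add)
    then show "c \<in> ?B" using sum by (auto simp: csum[symmetric] intro!: imageI)
  next
    fix c assume c: "c \<in> ?B"
    have "c = ?o \<oplus>\<^bsub>?A\<^esub> c" by (simp add: add)
    then show "c \<in> ?B <+>\<^bsub>?A\<^esub> ?B" using c B0 by (auto simp only: set_add_def')
  qed
  then show "\<zero>\<^bsub>H\<^esub> \<oplus>\<^bsub>H\<^esub> \<zero>\<^bsub>H\<^esub> = \<zero>\<^bsub>H\<^esub>"
    unfolding H_def cohomology_algebra_def by simp
qed

text \<open>Both inclusions are instances of the monotonicity in the support: a form and the sum of the
  coordinates in its support have the same support, and every form in \<open>k\<^sup>W\<close> has its support inside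
  that of \<open>z\<^sub>W\<close>.\<close>

lemma SR_resonance_forms:
  fixes V :: "'v set" and L :: "'v set set"
  defines "b \<equiv> \<lambda>\<zeta> :: 'v list \<Rightarrow> 'k::field. betti (SR_algebra V L :: ('k, _) graded_algebra) (SR_map V L \<zeta>)"
  assumes V: "finite V" and "i \<ge> 1"
  shows "{\<zeta> \<in> grade (tensor_algebra V) 1. b \<zeta> i \<ge> d} =
    (\<Union>W\<in>{W. W \<subseteq> V \<and> b (coord_sum W) i \<ge> d}. linear_forms V W)"
proof (intro equalityI subsetI)
  fix \<zeta> :: "'v list \<Rightarrow> 'k"
  assume \<zeta>: "\<zeta> \<in> {\<zeta> \<in> grade (tensor_algebra V) 1. b \<zeta> i \<ge> d}"
  let ?W = "{v. \<zeta> [v] \<noteq> 0}"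
  have W: "?W \<subseteq> V" using \<zeta> by (auto simp: mem_grade_tensor_algebra mem_tensor_algebra)
  then have fin: "finite ?W" by (rule finite_subset[OF _ V])
  have "b \<zeta> i \<le> b (coord_sum ?W) i"
    unfolding b_def using \<zeta> coord_sum_eval[OF fin, where ?'k = 'k] \<open>i \<ge> 1\<close>
    by (intro betti_support_antimono[OF V _ coord_sum_grade_one[OF fin W]]) (auto split: if_splits)
  then show "\<zeta> \<in> (\<Union>W\<in>{W. W \<subseteq> V \<and> b (coord_sum W) i \<ge> d}. linear_forms V W)"
    using \<zeta> W by (intro UN_I[of ?W]) (auto simp: linear_forms_def)
next
  fix \<zeta> :: "'v list \<Rightarrow> 'k"
  assume "\<zeta> \<in> (\<Union>W\<in>{W. W \<subseteq> V \<and> b (coord_sum W) i \<ge> d}. linear_forms V W)"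
  then obtain W where W: "W \<subseteq> V" "b (coord_sum W) i \<ge> d" and \<zeta>: "\<zeta> \<in> linear_forms V W" by blast
  have fin: "finite W" by (rule finite_subset[OF W(1) V])
  have "b (coord_sum W) i \<le> b \<zeta> i"
    unfolding b_def using \<zeta> coord_sum_eval[OF fin, where ?'k = 'k] \<open>i \<ge> 1\<close>
    by (intro betti_support_antimono[OF V coord_sum_grade_one[OF fin W(1)]])
      (auto simp: linear_forms_def)
  then show "\<zeta> \<in> {\<zeta> \<in> grade (tensor_algebra V) 1. b \<zeta> i \<ge> d}"
    using W(2) \<zeta> by (auto simp: linear_forms_def)
qed

theorem theorem3p8:
  fixes V :: "'v set" and L :: "'v set set" and i d :: nat
  assumes "simplicial_complex_on V L" and "i \<ge> 1" and "d \<ge> 1"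
  shows "resonance (SR_algebra V L :: ('k::field, _) graded_algebra) i d =
           (\<Union>W\<in>{W. W \<subseteq> V \<and> betti (SR_algebra V L :: ('k, _) graded_algebra) (SR_sum V L W) i \<ge> d}.
              coord_subspace V L W) \<and>
         (\<forall>\<phi> \<in> graded_algebra_iso (SR_algebra V L :: ('k, _) graded_algebra)
                  (cohomology_algebra (toric_complex V L)).
            resonance (cohomology_algebra (toric_complex V L) :: ('k, _) graded_algebra) i d =
              \<phi> ` (\<Union>W\<in>{W. W \<subseteq> V \<and> betti (SR_algebra V L :: ('k, _) graded_algebra) (SR_sum V L W) i \<ge> d}.
                     coord_subspace V L W))"
proof -
  let ?A = "SR_algebra V L :: ('k, _) graded_algebra"
  let ?H = "cohomology_algebra (toric_complex V L) :: ('k, _) graded_algebra"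
  let ?b = "\<lambda>\<zeta> :: 'v list \<Rightarrow> 'k. betti ?A (SR_map V L \<zeta>) i"
  define R where "R = {\<zeta> \<in> grade (tensor_algebra V) 1. ?b \<zeta> \<ge> d}"
  have V: "finite V" using assms(1) by (simp add: simplicial_complex_on_def)
  note onto = SR_algebra_onto[where V = V and L = L and ?'k = 'k]
  have eq: "SR_sum V L W = SR_map V L (coord_sum W :: 'v list \<Rightarrow> 'k)"
      "coord_subspace V L W = SR_map V L ` (linear_forms V W :: ('v list \<Rightarrow> 'k) set)"
    if "W \<subseteq> V" for W
    using that finite_subset[OF that V] by (auto simp only: SR_sum_map coord_subspace_map)
  have "(\<Union>W\<in>{W. W \<subseteq> V \<and> betti ?A (SR_sum V L W) i \<ge> d}.
        coord_subspace V L W :: ('v list \<Rightarrow> 'k) set set set) =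
      (\<Union>W\<in>{W. W \<subseteq> V \<and> ?b (coord_sum W) \<ge> d}. SR_map V L ` linear_forms V W)"
    by (intro SUP_cong Collect_cong) (auto simp: eq)
  also have "\<dots> = SR_map V L ` R"
    unfolding R_def SR_resonance_forms[OF V \<open>i \<ge> 1\<close>] by (rule image_UN[symmetric])
  finally have U: "(\<Union>W\<in>{W. W \<subseteq> V \<and> betti ?A (SR_sum V L W) i \<ge> d}.
        coord_subspace V L W :: ('v list \<Rightarrow> 'k) set set set) =
      SR_map V L ` R" .
  have "resonance ?H i d = \<phi> ` SR_map V L ` R" if iso: "\<phi> \<in> graded_algebra_iso ?A ?H" for \<phi>
  proof -
    note H = graded_algebra_iso_algebra_onto[OF onto iso cohomology_algebra_zero]
    have "betti ?H ((\<phi> \<circ> SR_map V L) \<zeta>) i = ?b \<zeta>" if "\<zeta> \<in> grade (tensor_algebra V) 1" for \<zeta>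
      using H(2) that \<open>i \<ge> 1\<close>
      by (intro betti_eq_of_kernel[OF V H(1) onto]) (auto simp: SR_kernel_def)
    then have "resonance ?H i d = (\<phi> \<circ> SR_map V L) ` R"
      unfolding resonance_image[OF H(1)] R_def by (intro image_cong) auto
    then show ?thesis by (simp add: image_comp)
  qed
  moreover have "resonance ?A i d = SR_map V L ` R"
    unfolding R_def by (rule resonance_image[OF onto])
  ultimately show ?thesis unfolding U by blast
qed

end
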